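(* Let $a,b,\mathfrak n:[0,\infty)\to[0,\infty)$ be continuous with $a(x)>0$ for all $x>0$, and suppose $\Phi(x):=b(x)/a(x)$ ($x>0$) has a limit $\Phi_0\in[0,\infty)$ as $x\to0^+$ (set $\Phi(0):=\Phi_0$). Assume moreover: (i) $\Phi$ is strictly increasing; (ii) $a',b'\in L^\infty(\varepsilon,\infty)$ for every $\varepsilon>0$; (iii) $\inf_{x\in(1,\infty)}a(x)>0$ and $1/a\in L^1(0,1)$; (iv) there is $C>0$ with $b(x)\Phi(x)\ge \frac1C\min(1,x^2)$ for all $x\ge0$; (v) there are $c>0$ and $k_0\ge1$ with $\mathfrak n(z)\ge c z^{k_0}$ for all $z\ge0$. Let $\rho>0$ and let $0\le f^{\rm in}\in L^1(\mathbb R_+,(1+x)dx)$ satisfy (vi) $\int_0^\infty\big(\int_0^x\Phi(z)\,dz+x^2\big)f^{\rm in}(x)\,dx<\infty$. Then every global solution $f$ of the Lifshitz--Slyozov equation with nucleation, with data $f^{\rm in}$ and $\rho$, satisfies, with $u(t)=\rho-\int_0^\infty xf(t,x)\,dx$ and $M_0(t)=\int_0^\infty f(t,x)\,dx$: - $\lim_{t\to+\infty}M_0(t)=+\infty$; - $\lim_{t\to+\infty}u(t)=\Phi_0$; - $\lim_{t\to+\infty}xf(t,x)\,dx=(\rho-\Phi_0)\,\delta_0$ weakly in $\mathcal M^+_\rho([0,\infty))$.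
   Context: $\mathbb R_+=(0,\infty)$. $L^1(\mathbb R_+,(1+x)dx)$ is the space of functions integrable with respect to the measure $(1+x)dx$; $\mathcal C([0,\infty),w\text{-}L^1(\mathbb R_+,(1+x)dx))$ is the set of maps $f$ from $[0,\infty)$ to this space such that $t\mapsto\int_0^\infty f(t,x)\varphi(x)(1+x)\,dx$ is continuous for every $\varphi\in L^\infty(0,\infty)$. Global solution: given $0\le f^{\rm in}\in L^1(\mathbb R_+,(1+x)dx)$ and $\rho>0$, a function $0\le f\in\mathcal C([0,\infty),w\text{-}L^1(\mathbb R_+,(1+x)dx))$ is a global solution of the Lifshitz--Slyozov equation with nucleation if, with $u(t):=\rho-\int_0^\infty xf(t,x)\,dx$: (1) for all $t\ge0$ and every $\varphi\in\mathcal C^0([0,\infty))$ with $\varphi'\in L^\infty(0,\infty)$, $$\int_0^\infty\varphi(x)f(t,x)\,dx=\int_0^\infty\varphi(x)f^{\rm in}(x)\,dx+\int_0^t\!\int_0^\infty(a(x)u(s)-b(x))\varphi'(x)f(s,x)\,dx\,ds+\int_0^t\varphi(0)\,\mathfrak n(u(s))\,ds;$$ (2) $u(t)>\Phi_0$ for all $t\ge0$. $\mathcal M^+_\rho([0,\infty))$ is the set of nonnegative Radon measures on $[0,\infty)$ with total mass at most $\rho$; weak convergence in it means convergence of integrals against every bounded continuous function on $[0,\infty)$. $\delta_0$ is the Dirac mass at $0$. *)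

theory Defs
  imports "HOL-Probability.Probability"
begin

text \<open>
  Functions on \<open>[0,\<infinity>)\<close> or \<open>(0,\<infinity>)\<close> are total functions on the reals whose values outside the
  half-line are never used. Elements of Lebesgue spaces are given by Borel representatives.
\<close>

definition L1_weighted :: "(real \<Rightarrow> real) set" where
  "L1_weighted = {g. set_integrable lborel {0<..} (\<lambda>x. g x * (1 + x))}"

definition Linfty :: "real set \<Rightarrow> (real \<Rightarrow> real) set" where
  "Linfty S = {g. set_borel_measurable lborel S g \<and> (\<exists>C. AE x\<in>S in lborel. \<bar>g x\<bar> \<le> C)}"

text \<open>
  Weak derivative on an open interval \<open>S\<close>, tested against continuously differentiable functions
  with compact support in \<open>S\<close>; only used for \<open>\<phi>\<close> continuous on \<open>S\<close> and \<open>g\<close> locally bounded.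
\<close>

definition weak_derivative_on :: "(real \<Rightarrow> real) \<Rightarrow> (real \<Rightarrow> real) \<Rightarrow> real set \<Rightarrow> bool" where
  "weak_derivative_on \<phi> g S \<longleftrightarrow>
     (\<forall>\<psi> \<psi>' K.
        (\<forall>x. (\<psi> has_real_derivative \<psi>' x) (at x)) \<and> continuous_on UNIV \<psi>' \<and>
        compact K \<and> K \<subseteq> S \<and> (\<forall>x. x \<notin> K \<longrightarrow> \<psi> x = 0) \<longrightarrow>
        (LBINT x:S. \<phi> x * \<psi>' x) = - (LBINT x:S. g x * \<psi> x))"

definition derivative_in_Linfty :: "(real \<Rightarrow> real) \<Rightarrow> real set \<Rightarrow> bool" where
  "derivative_in_Linfty \<phi> S \<longleftrightarrow> (\<exists>g\<in>Linfty S. weak_derivative_on \<phi> g S)"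

definition weakly_continuous_L1 :: "(real \<Rightarrow> real \<Rightarrow> real) \<Rightarrow> bool" where
  "weakly_continuous_L1 f \<longleftrightarrow>
     (\<forall>t\<ge>0. f t \<in> L1_weighted) \<and>
     (\<forall>\<phi>\<in>Linfty {0<..}. continuous_on {0..} (\<lambda>t. LBINT x:{0<..}. f t x * \<phi> x * (1 + x)))"

definition Phi :: "(real \<Rightarrow> real) \<Rightarrow> (real \<Rightarrow> real) \<Rightarrow> real \<Rightarrow> real \<Rightarrow> real" where
  "Phi a b \<Phi>0 x = (if x = 0 then \<Phi>0 else b x / a x)"

definition monomer :: "real \<Rightarrow> (real \<Rightarrow> real \<Rightarrow> real) \<Rightarrow> real \<Rightarrow> real" where
  "monomer \<rho> f t = \<rho> - (LBINT x:{0<..}. x * f t x)"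

definition moment0 :: "(real \<Rightarrow> real \<Rightarrow> real) \<Rightarrow> real \<Rightarrow> real" where
  "moment0 f t = (LBINT x:{0<..}. f t x)"

text \<open>
  In the weak formulation \<open>g\<close> stands for \<open>\<phi>'\<close>; it is unique up to null sets, so the choice of
  representative does not affect the integrals.
\<close>

definition LS_global_solution ::
  "(real \<Rightarrow> real) \<Rightarrow> (real \<Rightarrow> real) \<Rightarrow> (real \<Rightarrow> real) \<Rightarrow> real \<Rightarrow> real \<Rightarrow>
   (real \<Rightarrow> real) \<Rightarrow> (real \<Rightarrow> real \<Rightarrow> real) \<Rightarrow> bool" where
  "LS_global_solution a b nuc \<Phi>0 \<rho> fin f \<longleftrightarrow>
     (\<forall>t\<ge>0. AE x\<in>{0<..} in lborel. 0 \<le> f t x) \<and>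
     weakly_continuous_L1 f \<and>
     (\<forall>t\<ge>0. \<forall>\<phi> g.
        continuous_on {0..} \<phi> \<and> g \<in> Linfty {0<..} \<and> weak_derivative_on \<phi> g {0<..} \<longrightarrow>
        (LBINT x:{0<..}. \<phi> x * f t x) =
          (LBINT x:{0<..}. \<phi> x * fin x)
          + (LBINT s:{0..t}. LBINT x:{0<..}. (a x * monomer \<rho> f s - b x) * g x * f s x)
          + (LBINT s:{0..t}. \<phi> 0 * nuc (monomer \<rho> f s))) \<and>
     (\<forall>t\<ge>0. \<Phi>0 < monomer \<rho> f t)"

text \<open>
  Finite Borel measures on \<open>[0,\<infinity>)\<close> are automatically Radon.
\<close>

definition radon_measures_le :: "real \<Rightarrow> real measure set" where
  "radon_measures_le \<rho> =
     {\<mu>. sets \<mu> = sets (restrict_space borel {0..}) \<and> emeasure \<mu> {0..} \<le> ennreal \<rho>}"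

definition weakly_tendsto_at_top :: "real \<Rightarrow> (real \<Rightarrow> real measure) \<Rightarrow> real measure \<Rightarrow> bool" where
  "weakly_tendsto_at_top \<rho> \<mu> \<nu> \<longleftrightarrow>
     (\<forall>t\<ge>0. \<mu> t \<in> radon_measures_le \<rho>) \<and> \<nu> \<in> radon_measures_le \<rho> \<and>
     (\<forall>\<psi>::real \<Rightarrow> real. continuous_on {0..} \<psi> \<and> bounded (\<psi> ` {0..}) \<longrightarrow>
        ((\<lambda>t. \<integral>x. \<psi> x \<partial>\<mu> t) \<longlongrightarrow> (\<integral>x. \<psi> x \<partial>\<nu>)) at_top)"

definition mass_measure :: "(real \<Rightarrow> real) \<Rightarrow> real measure" where
  "mass_measure h = density (restrict_space lborel {0..}) (\<lambda>x. ennreal (x * h x))"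

definition dirac0 :: "real measure" where
  "dirac0 = return (restrict_space borel {0..}) 0"

end

theory Submission
  imports Defs
begin

text \<open>
  Testing the equation with \<open>\<phi>(x) = x\<close> bounds the rate at which \<open>u\<close> can increase while it stays
  above \<open>\<Phi>0 + \<delta>\<close>. Hence, if \<open>u\<close> did not converge to \<open>\<Phi>0\<close>, it would exceed \<open>\<Phi>0 + \<delta>\<close> on infinitely
  many time windows of a fixed length \<open>\<tau>\<close>, nucleation would make \<open>M\<^sub>0\<close> unbounded, and, since \<open>1 / a\<close> is
  integrable near \<open>0\<close>, a fixed fraction of these many particles would reach a fixed size within
  such a window. This contradicts the bound \<open>\<rho>\<close> on the first moment.

  Once \<open>u\<close> is close to \<open>\<Phi>0\<close>, every size \<open>x \<ge> p\<close> is strictly shrinking, since \<open>\<Phi>(p) > \<Phi>0\<close>. So the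
  mass above \<open>R \<ge> p\<close> decreases in time, which gives tightness, and the number of particles above \<open>p\<close>
  is integrable in time. Together they force the mass above \<open>p\<close> to vanish in the limit. Finally, a
  bounded \<open>M\<^sub>0\<close> would let the whole mass vanish, although it tends to \<open>\<rho> - \<Phi>0 > 0\<close>.
\<close>

section \<open>Weak derivatives\<close>

text \<open>The information on \<open>f\<close> is integrability against \<open>1 + x\<close> and
  weak continuity in time, so the argument runs entirely on moments with weights of at most linear
  growth: these are finite and continuous in time. For the drift to be such a weight, (ii) is first
  turned into linear growth of \<open>a\<close> and \<open>b\<close>. The delicate point is the
  convergence of \<open>u\<close>. Unboundedness of the number of particles alone contradicts
  nothing, since particles may be arbitrarily small. But where \<open>u\<close> exceeds \<Phi> by at
  least \<delta>, sizes grow at speed at least \<delta> a(x), so (0, 2q) is crossed within time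
  1/\<delta> times the integral of 1/a over (0, 2q). This tends to 0 with q, whereas the window
  length \<tau> does not depend on the number of particles; q is chosen so that the crossing takes
  at most \<tau>/2. As \<open>nuc\<close> is bounded on \<open>{0..\<rho>}\<close>, particles born
  during the window are negligible against a large initial number and cannot spoil the
  count.\<close>

lemma weak_derivative_onI:
  fixes \<phi> g :: "real \<Rightarrow> real"
  assumes deriv: "\<And>x. 0 < x \<Longrightarrow> (\<phi> has_real_derivative g x) (at x)"
    and cont: "continuous_on {0<..} g"
  shows "weak_derivative_on \<phi> g {0<..}"
  unfolding weak_derivative_on_def
proof (intro allI impI)
  fix \<psi> \<psi>' K
  assume A: "(\<forall>x. (\<psi> has_real_derivative \<psi>' x) (at x)) \<and> continuous_on UNIV \<psi>' \<and>
        compact K \<and> K \<subseteq> {0<..} \<and> (\<forall>x. x \<notin> K \<longrightarrow> \<psi> x = (0::real))"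
  then have d: "\<And>x. (\<psi> has_real_derivative \<psi>' x) (at x)" and c: "continuous_on UNIV \<psi>'"
    and K: "compact K" "K \<subseteq> {0<..}" and z: "\<And>x. x \<notin> K \<Longrightarrow> \<psi> x = 0" by auto
  obtain m M where mM: "0 < m" "m \<le> M" "K \<subseteq> {m<..<M}"
  proof (cases "K = {}")
    case True
    then show ?thesis using that[of 1 1] by auto
  next
    case False
    obtain l where l: "l \<in> K" "\<forall>x\<in>K. l \<le> x" using compact_attains_inf[OF K(1) False] by blast
    obtain h where h: "h \<in> K" "\<forall>x\<in>K. x \<le> h" using compact_attains_sup[OF K(1) False] by blast
    have "0 < l" using l K by auto
    then show ?thesis using l h that[of "l/2" "h+1"] by force
  qed
  \<comment> \<open>\<open>\<psi>\<close> vanishes on the open complement of \<open>K\<close>, hence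
    so does its derivative. Both integrands then live on \<open>{m..M}\<close>, where integration by
    parts leaves no boundary terms.\<close>
  have z': "\<psi>' x = 0" if "x \<notin> K" for x
  proof -
    have "open (- K)" using K compact_imp_closed by blast
    then have "(\<psi> has_real_derivative 0) (at x)"
      using that z by (rule_tac has_field_derivative_transform_within_open[where S = "- K", OF DERIV_const[of 0]]) auto
    then show ?thesis using d DERIV_unique by blast
  qed
  have cg: "isCont g x" if "x > 0" for x
    using cont that continuous_on_eq_continuous_at[of "{0<..}" g] by auto
  have cp: "isCont \<phi> x" if "x > 0" for x using deriv[OF that] DERIV_isCont by blast
  have cs: "isCont \<psi> x" for x using d DERIV_isCont by blast
  have cs': "isCont \<psi>' x" for x using c continuous_on_eq_continuous_at[of UNIV \<psi>'] by auto
  let ?I = "indicator {m..M} :: real \<Rightarrow> real"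
  have i1: "integrable lborel (\<lambda>x. (\<phi> x * \<psi>' x) * ?I x)"
    using mM by (intro borel_integrable_atLeastAtMost continuous_intros cp cs') auto
  have i2: "integrable lborel (\<lambda>x. (g x * \<psi> x) * ?I x)"
    using mM by (intro borel_integrable_atLeastAtMost continuous_intros cg cs) auto
  have "(\<integral>x. (\<phi> x * \<psi>' x + g x * \<psi> x) * ?I x \<partial>lborel) = \<phi> M * \<psi> M - \<phi> m * \<psi> m"
    using mM
    by (intro integral_FTC_Icc_real continuous_intros cg cs cs' cp)
       (auto intro!: derivative_eq_intros deriv d)
  also have "\<dots> = 0"
  proof -
    have "M \<notin> K" "m \<notin> K" using mM(3) by auto
    then show ?thesis using z by simp
  qed
  finally have "(\<integral>x. (\<phi> x * \<psi>' x) * ?I x + (g x * \<psi> x) * ?I x \<partial>lborel) = 0"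
    by (simp add: distrib_right)
  then have s: "(\<integral>x. (\<phi> x * \<psi>' x) * ?I x \<partial>lborel) + (\<integral>x. (g x * \<psi> x) * ?I x \<partial>lborel) = 0"
    using Bochner_Integration.integral_add[OF i1 i2] by simp
  have "(LBINT x:{0<..}. \<phi> x * \<psi>' x) = (\<integral>x. (\<phi> x * \<psi>' x) * ?I x \<partial>lborel)"
    unfolding set_lebesgue_integral_def
  proof (rule Bochner_Integration.integral_cong[OF refl])
    fix x show "indicator {0<..} x *\<^sub>R (\<phi> x * \<psi>' x) = \<phi> x * \<psi>' x * ?I x"
      using mM z'[of x] by (cases "x \<in> K") (auto simp: indicator_def)
  qed
  moreover have "(LBINT x:{0<..}. g x * \<psi> x) = (\<integral>x. (g x * \<psi> x) * ?I x \<partial>lborel)"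
    unfolding set_lebesgue_integral_def
  proof (rule Bochner_Integration.integral_cong[OF refl])
    fix x show "indicator {0<..} x *\<^sub>R (g x * \<psi> x) = g x * \<psi> x * ?I x"
      using mM z[of x] by (cases "x \<in> K") (auto simp: indicator_def)
  qed
  ultimately show "(LBINT x:{0<..}. \<phi> x * \<psi>' x) = - (LBINT x:{0<..}. g x * \<psi> x)"
    using s by simp
qed

section \<open>Smooth steps and local averages\<close>

text \<open>Half the second difference of the squared positive part: a step from 0 at -1 to 1 at 1,
  continuously differentiable as the test functions in \<open>weak_derivative_on\<close> must
  be.\<close>

definition smooth_ramp :: "real \<Rightarrow> real" where
  "smooth_ramp z = ((max 0 (z + 1))\<^sup>2 - 2 * (max 0 z)\<^sup>2 + (max 0 (z - 1))\<^sup>2) / 2"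

text \<open>The triangular B-spline supported on [-1, 1], with integral 1; it is the derivative of
  \<open>smooth_ramp\<close>.\<close>

definition hat :: "real \<Rightarrow> real" where
  "hat z = max 0 (z + 1) - 2 * max 0 z + max 0 (z - 1)"

lemma has_real_derivative_pos_part_square:
  fixes z :: real
  shows "((\<lambda>z. (max 0 z)\<^sup>2) has_real_derivative 2 * max 0 z) (at z)"
proof -
  consider "z < 0" | "z > 0" | "z = 0" by linarith
  then show ?thesis
  proof cases
    case 1
    show ?thesis
    proof (rule has_field_derivative_transform_within_open)
      show "((\<lambda>_. 0) has_real_derivative 2 * max 0 z) (at z)" using 1 by simp
      show "open {..<0::real}" "z \<in> {..<0}" using 1 by auto
    qed (simp add: max_def)
  next
    case 2
    show ?thesis
    proof (rule has_field_derivative_transform_within_open)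
      show "((\<lambda>z. z\<^sup>2) has_real_derivative 2 * max 0 z) (at z)"
        using 2 by (auto intro!: derivative_eq_intros)
      show "open {0::real<..}" "z \<in> {0<..}" using 2 by auto
    qed (simp add: max_def)
  next
    case 3
    have "((\<lambda>h::real. (max 0 h)\<^sup>2 / h) \<longlongrightarrow> 0) (at 0)"
    proof (rule Lim_null_comparison)
      show "\<forall>\<^sub>F h in at (0::real). norm ((max 0 h)\<^sup>2 / h) \<le> \<bar>h\<bar>"
        by (intro always_eventually allI) (auto simp: max_def power2_eq_square)
      show "((\<lambda>h::real. \<bar>h\<bar>) \<longlongrightarrow> 0) (at 0)"
        by (rule tendsto_rabs_zero) (rule tendsto_ident_at)
    qed
    then show ?thesis using 3 by (simp add: has_field_derivative_iff)
  qed
qed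

lemma has_real_derivative_smooth_ramp: "(smooth_ramp has_real_derivative hat z) (at z)"
proof -
  have 1: "((\<lambda>z. (max 0 (z + c))\<^sup>2) has_real_derivative 2 * max 0 (z + c)) (at z)" for c :: real
    using DERIV_shift[of "\<lambda>z. (max 0 z)\<^sup>2" "2 * max 0 (z + c)" z c]
      has_real_derivative_pos_part_square[of "z + c"] by simp
  show ?thesis unfolding smooth_ramp_def hat_def
    by (rule DERIV_cong, rule DERIV_cdivide, rule DERIV_add[OF DERIV_diff[OF 1[of 1]
          DERIV_cmult[OF has_real_derivative_pos_part_square]] 1[of "-1", simplified]])
       (simp add: field_simps)
qed

lemma smooth_ramp_le: "z \<le> -1 \<Longrightarrow> smooth_ramp z = 0"
  by (simp add: smooth_ramp_def)

lemma smooth_ramp_ge: "z \<ge> 1 \<Longrightarrow> smooth_ramp z = 1"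
  by (simp add: smooth_ramp_def max_def power2_eq_square algebra_simps)

lemma hat_nonneg: "0 \<le> hat z"
  by (simp add: hat_def max_def)

lemma hat_outside: "\<bar>z\<bar> \<ge> 1 \<Longrightarrow> hat z = 0"
  by (auto simp: hat_def max_def abs_if split: if_splits)

lemma smooth_ramp_mono: "y \<le> z \<Longrightarrow> smooth_ramp y \<le> smooth_ramp z"
  by (erule DERIV_nonneg_imp_nondecreasing) (use has_real_derivative_smooth_ramp hat_nonneg in blast)

lemma smooth_ramp_nonneg: "0 \<le> smooth_ramp z"
  using smooth_ramp_mono[of "min z (-1)" z] smooth_ramp_le[of "min z (-1)"] by simp

lemma smooth_ramp_le_1: "smooth_ramp z \<le> 1"
  using smooth_ramp_mono[of z "max z 1"] smooth_ramp_ge[of "max z 1"] by simp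

lemma continuous_on_hat [continuous_intros]:
  "continuous_on A f \<Longrightarrow> continuous_on A (\<lambda>x. hat (f x))"
  unfolding hat_def by (intro continuous_intros)

text \<open>Rescaled to half-width \<open>d\<close>, \<open>hat\<close> is a probability density:
  its integral is the increment of \<open>smooth_ramp\<close>. Averaging against it moves
  \<open>h c\<close> by at most the oscillation of \<open>h\<close> about \<open>c\<close>.\<close>

lemma hat_average:
  fixes h :: "real \<Rightarrow> real"
  assumes "0 < d" and cont: "continuous_on {c - d..c + d} h"
    and close: "\<And>x. \<bar>x - c\<bar> \<le> d \<Longrightarrow> \<bar>h x - h c\<bar> \<le> \<eta>"
  shows "integrable lborel (\<lambda>x. indicator {c-d..c+d} x * (h x * (hat ((x - c) / d) / d)))"
    and "\<bar>(\<integral>x. indicator {c-d..c+d} x * (h x * (hat ((x - c) / d) / d)) \<partial>lborel) - h c\<bar> \<le> \<eta>"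
proof -
  let ?k = "\<lambda>x. hat ((x - c) / d) / d"
  have ck: "continuous_on {c-d..c+d} ?k"
    using assms(1) by (intro continuous_intros) auto
  show i: "integrable lborel (\<lambda>x. indicator {c-d..c+d} x * (h x * ?k x))"
    using borel_integrable_atLeastAtMost'[OF continuous_on_mult[OF cont ck]]
    by (simp add: set_integrable_def)
  have "has_bochner_integral lborel (\<lambda>x. ?k x * indicator {c-d..c+d} x)
      (smooth_ramp ((c + d - c) / d) - smooth_ramp ((c - d - c) / d))"
  proof (rule has_bochner_integral_FTC_Icc_real)
    fix x
    show "((\<lambda>x. smooth_ramp ((x - c) / d)) has_real_derivative hat ((x - c) / d) / d) (at x)"
      by (rule DERIV_cong[OF DERIV_chain2[OF has_real_derivative_smooth_ramp]])
        (use assms(1) in \<open>auto intro!: derivative_eq_intros\<close>)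
    have "continuous_on UNIV ?k" using assms(1) by (intro continuous_intros) auto
    then show "isCont ?k x" using continuous_on_eq_continuous_at[of UNIV ?k] by auto
  qed (use assms(1) in auto)
  then have hb: "has_bochner_integral lborel (\<lambda>x. indicator {c-d..c+d} x * ?k x) 1"
    using assms(1) by (simp add: smooth_ramp_le smooth_ramp_ge mult.commute)
  have k0: "0 \<le> ?k x" for x using hat_nonneg assms(1) by simp
  have hb': "has_bochner_integral lborel (\<lambda>x. e * (indicator {c-d..c+d} x * ?k x)) e" for e
    using has_bochner_integral_mult_right[OF hb, of e] by simp
  let ?J = "\<integral>x. indicator {c-d..c+d} x * (h x * (hat ((x - c) / d) / d)) \<partial>lborel"
  have up: "?J \<le> h c + \<eta>"
  proof -
    have "?J \<le> (\<integral>x. (h c + \<eta>) * (indicator {c-d..c+d} x * ?k x) \<partial>lborel)"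
    proof (rule integral_mono[OF i])
      fix x
      show "indicator {c-d..c+d} x * (h x * ?k x) \<le> (h c + \<eta>) * (indicator {c-d..c+d} x * ?k x)"
        using close[of x] mult_right_mono[OF _ k0[of x], of "h x" "h c + \<eta>"]
        by (auto simp: indicator_def abs_le_iff)
    qed (use hb' has_bochner_integral_iff in blast)
    then show ?thesis using has_bochner_integral_integral_eq[OF hb'] by metis
  qed
  have lo: "h c - \<eta> \<le> ?J"
  proof -
    have "(\<integral>x. (h c - \<eta>) * (indicator {c-d..c+d} x * ?k x) \<partial>lborel) \<le> ?J"
    proof (rule integral_mono[OF _ i])
      fix x
      show "(h c - \<eta>) * (indicator {c-d..c+d} x * ?k x) \<le> indicator {c-d..c+d} x * (h x * ?k x)"
        using close[of x] mult_right_mono[OF _ k0[of x], of "h c - \<eta>" "h x"]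
        by (auto simp: indicator_def abs_le_iff)
    qed (use hb' has_bochner_integral_iff in blast)
    then show ?thesis using has_bochner_integral_integral_eq[OF hb'] by metis
  qed
  show "\<bar>?J - h c\<bar> \<le> \<eta>" using up lo by auto
qed

text \<open>The derivative is only known through test functions, so \<open>h 2\<close> and
  \<open>h y\<close> are compared through local averages. The test function is a plateau from 2 to
  \<open>y\<close>, whose derivative is an averaging kernel at 2 minus one at \<open>y\<close>; the
  weak identity then bounds the difference of the averages by
  \<open>\<bar>C0\<bar> * y\<close>.\<close>

lemma derivative_in_Linfty_imp_linear_growth:
  assumes cont: "continuous_on {0..} h" and D: "derivative_in_Linfty h {1<..}"
  obtains C where "0 \<le> C" "\<And>x. 0 \<le> x \<Longrightarrow> \<bar>h x\<bar> \<le> C * (1 + x)"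
proof -
  from D obtain g where g: "g \<in> Linfty {1<..}" and wd: "weak_derivative_on h g {1<..}"
    unfolding derivative_in_Linfty_def by blast
  obtain C0 where C0: "AE x\<in>{1<..} in lborel. \<bar>g x\<bar> \<le> C0" and gm: "set_borel_measurable lborel {1<..} g"
    using g unfolding Linfty_def by auto
  have far: "\<bar>h y - h 2\<bar> \<le> 2 + \<bar>C0\<bar> * y" if y: "y > 3" for y
  proof -
    have ex: "\<exists>d>0. \<forall>x. \<bar>x - c\<bar> \<le> d \<longrightarrow> \<bar>h x - h c\<bar> \<le> 1" if "c > 0" for c
    proof -
      have "isCont h c" using cont that continuous_on_interior[of "{0..}" h c] by simp
      then obtain d where "d > 0" "\<forall>x. norm (x - c) < d \<longrightarrow> norm (h x - h c) < 1"
        using LIM_D[of h "h c" c 1] unfolding isCont_def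
        by (metis norm_zero right_minus_eq zero_less_one)
      then show ?thesis by (intro exI[of _ "d/2"]) (auto simp: less_imp_le)
    qed
    obtain d1 where d1: "d1 > 0" "\<And>x. \<bar>x - 2\<bar> \<le> d1 \<Longrightarrow> \<bar>h x - h 2\<bar> \<le> 1" using ex[of 2] by auto
    obtain d2 where d2: "d2 > 0" "\<And>x. \<bar>x - y\<bar> \<le> d2 \<Longrightarrow> \<bar>h x - h y\<bar> \<le> 1" using ex[of y] y by auto
    \<comment> \<open>The value 1/2 keeps the support of the test function inside
      \<open>{1<..}\<close>; \<open>d1\<close> and \<open>d2\<close> keep the oscillation of
      \<open>h\<close> about 2 and about \<open>y\<close> at most 1.\<close>
    define d where "d = min (1/2) (min d1 d2)"
    have d: "0 < d" "d \<le> 1/2" "d \<le> d1" "d \<le> d2" using d1 d2 by (auto simp: d_def)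
    define \<psi> where "\<psi> x = smooth_ramp ((x - 2) / d) - smooth_ramp ((x - y) / d)" for x
    define \<psi>' where "\<psi>' x = hat ((x - 2) / d) / d - hat ((x - y) / d) / d" for x
    have d\<psi>: "(\<psi> has_real_derivative \<psi>' x) (at x)" for x
    proof -
      have "((\<lambda>x. smooth_ramp ((x - c) / d)) has_real_derivative hat ((x - c) / d) / d) (at x)" for c
        by (rule DERIV_cong[OF DERIV_chain2[OF has_real_derivative_smooth_ramp]])
           (use d in \<open>auto intro!: derivative_eq_intros\<close>)
      then show ?thesis unfolding \<psi>_def \<psi>'_def by (intro DERIV_diff)
    qed
    have c\<psi>': "continuous_on UNIV \<psi>'"
      unfolding \<psi>'_def using d by (intro continuous_intros) auto
    have z\<psi>: "\<psi> x = 0" if "x \<notin> {2 - d..y + d}" for x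
    proof -
      from that consider "x < 2 - d" | "x > y + d" by force
      then show ?thesis
      proof cases
        case 1
        then have "(x - 2) / d \<le> -1" "(x - y) / d \<le> -1"
          using d y by (auto simp: field_simps)
        then show ?thesis by (simp add: \<psi>_def smooth_ramp_le)
      next
        case 2
        then have "(x - 2) / d \<ge> 1" "(x - y) / d \<ge> 1"
          using d y by (auto simp: field_simps)
        then show ?thesis by (simp add: \<psi>_def smooth_ramp_ge)
      qed
    qed
    have b\<psi>: "\<bar>\<psi> x\<bar> \<le> 1" for x
      using smooth_ramp_nonneg[of "(x - 2) / d"] smooth_ramp_nonneg[of "(x - y) / d"]
        smooth_ramp_le_1[of "(x - 2) / d"] smooth_ramp_le_1[of "(x - y) / d"]
      by (simp add: \<psi>_def)
    have sub: "compact {2 - d..y + d}" "{2 - d..y + d} \<subseteq> {1<..}"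
      using d by (simp, intro subsetI, simp)
    have eq: "(LBINT x:{1<..}. h x * \<psi>' x) = - (LBINT x:{1<..}. g x * \<psi> x)"
      using wd[unfolded weak_derivative_on_def, rule_format, of \<psi> \<psi>' "{2 - d..y + d}"]
        d\<psi> c\<psi>' z\<psi> sub by blast
    have r: "\<bar>LBINT x:{1<..}. g x * \<psi> x\<bar> \<le> \<bar>C0\<bar> * y"
    proof -
      have "\<bar>LBINT x:{1<..}. g x * \<psi> x\<bar> \<le> (\<integral>x. norm (indicator {1<..} x *\<^sub>R (g x * \<psi> x)) \<partial>lborel)"
        unfolding set_lebesgue_integral_def real_norm_def[symmetric]
        by (rule integral_norm_bound)
      also have "\<dots> \<le> (\<integral>x. \<bar>C0\<bar> * indicator {2-d..y+d} x \<partial>lborel)"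
      proof (rule integral_mono_AE)
        have m\<psi>: "\<psi> \<in> borel_measurable borel"
          using d\<psi> by (intro borel_measurable_continuous_onI continuous_at_imp_continuous_on)
             (auto intro: DERIV_isCont)
        have AEb: "AE x in lborel. norm (indicator {1<..} x *\<^sub>R (g x * \<psi> x)) \<le> \<bar>C0\<bar> * indicator {2-d..y+d} x"
          using C0
        proof eventually_elim
          case (elim x)
          show ?case
          proof (cases "x \<in> {2-d..y+d}")
            case True
            then have "\<bar>g x\<bar> \<le> \<bar>C0\<bar>" using elim d by auto
            then have "\<bar>g x\<bar> * \<bar>\<psi> x\<bar> \<le> \<bar>C0\<bar> * 1" using b\<psi>[of x] by (intro mult_mono) auto
            then show ?thesis using True by (auto simp: indicator_def abs_mult)
          qed (use z\<psi> in auto)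
        qed
        show int: "integrable lborel (\<lambda>x. \<bar>C0\<bar> * indicator {2-d..y+d} x)"
          using d y by (intro integrable_mult_right integrable_real_indicator) auto
        have "(\<lambda>x. indicator {1<..} x *\<^sub>R g x * \<psi> x) \<in> borel_measurable lborel"
          using gm m\<psi> unfolding set_borel_measurable_def by (intro borel_measurable_times) auto
        then have "(\<lambda>x. indicator {1<..} x *\<^sub>R (g x * \<psi> x)) \<in> borel_measurable lborel"
          by (simp add: mult.assoc)
        then show "integrable lborel (\<lambda>x. norm (indicator {1<..} x *\<^sub>R (g x * \<psi> x)))"
          by (intro integrable_norm, rule_tac Bochner_Integration.integrable_bound[OF int]) (use AEb in \<open>auto elim!: eventually_mono\<close>)
        show "AE x in lborel. norm (indicator {1<..} x *\<^sub>R (g x * \<psi> x)) \<le> \<bar>C0\<bar> * indicator {2-d..y+d} x"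
          by (rule AEb)
      qed
      also have "\<dots> = \<bar>C0\<bar> * (y - 2 + 2 * d)" using d y by simp
      also have "\<dots> \<le> \<bar>C0\<bar> * y" using d by (intro mult_left_mono) auto
      finally show ?thesis .
    qed
    have ct: "continuous_on {c - d..c + d} h" if "c \<ge> 2" for c
      using cont by (rule continuous_on_subset) (use that d in auto)
    note a1 = hat_average[OF d(1) ct[of 2], of 1] 
    note a2 = hat_average[OF d(1) ct[of y], of 1] 
    have l: "(LBINT x:{1<..}. h x * \<psi>' x) =
       (\<integral>x. indicator {2-d..2+d} x * (h x * (hat ((x - 2) / d) / d)) \<partial>lborel)
      - (\<integral>x. indicator {y-d..y+d} x * (h x * (hat ((x - y) / d) / d)) \<partial>lborel)"
    proof -
      have e: "indicator {1<..} x * (h x * (hat ((x - c) / d) / d)) =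
        indicator {c-d..c+d} x * (h x * (hat ((x - c) / d) / d))" if "c \<ge> 2" for c x
      proof (cases "x \<in> {c-d..c+d}")
        case False
        then have "\<bar>(x - c) / d\<bar> \<ge> 1" using d by (auto simp: field_simps abs_if)
        then show ?thesis by (simp add: hat_outside)
      qed (use that d in \<open>auto simp: indicator_def\<close>)
      have "(LBINT x:{1<..}. h x * \<psi>' x) =
       (\<integral>x. indicator {2-d..2+d} x * (h x * (hat ((x - 2) / d) / d))
        - indicator {y-d..y+d} x * (h x * (hat ((x - y) / d) / d)) \<partial>lborel)"
        unfolding set_lebesgue_integral_def
      proof (rule Bochner_Integration.integral_cong[OF refl])
        fix x
        have "indicator {1<..} x *\<^sub>R (h x * \<psi>' x) = indicator {1<..} x * (h x * (hat ((x - 2) / d) / d))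
          - indicator {1<..} x * (h x * (hat ((x - y) / d) / d))"
          by (simp add: \<psi>'_def right_diff_distrib)
        then show "indicator {1<..} x *\<^sub>R (h x * \<psi>' x) = indicator {2-d..2+d} x * (h x * (hat ((x - 2) / d) / d))
          - indicator {y-d..y+d} x * (h x * (hat ((x - y) / d) / d))"
          using y by (simp only: e[OF order_refl] e[of y])
      qed
      also have "\<dots> = (\<integral>x. indicator {2-d..2+d} x * (h x * (hat ((x - 2) / d) / d)) \<partial>lborel)
      - (\<integral>x. indicator {y-d..y+d} x * (h x * (hat ((x - y) / d) / d)) \<partial>lborel)"
        by (intro Bochner_Integration.integral_diff a1(1) a2(1)) (use d1(2) d2(2) d y in auto)
      finally show ?thesis .
    qed
    have "\<bar>(\<integral>x. indicator {2-d..2+d} x * (h x * (hat ((x - 2) / d) / d)) \<partial>lborel) - h 2\<bar> \<le> 1"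
      by (rule a1(2)) (use d1(2) d in auto)
    moreover have "\<bar>(\<integral>x. indicator {y-d..y+d} x * (h x * (hat ((x - y) / d) / d)) \<partial>lborel) - h y\<bar> \<le> 1"
      by (rule a2(2)) (use d2(2) d y in auto)
    ultimately show ?thesis using eq r l by linarith
  qed
  have "compact (h ` {0..3})"
    by (intro compact_continuous_image continuous_on_subset[OF cont]) auto
  then have "\<exists>B. \<forall>x\<in>{0..3}. \<bar>h x\<bar> \<le> B"
    using compact_imp_bounded[of "h ` {0..3}"] by (simp add: bounded_iff)
  then obtain B where "\<forall>x\<in>{0..3}. \<bar>h x\<bar> \<le> B" by blast
  then have B: "\<And>x. 0 \<le> x \<Longrightarrow> x \<le> 3 \<Longrightarrow> \<bar>h x\<bar> \<le> B" by simp
  have B0: "0 \<le> B" using B[of 0] by auto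
  show ?thesis
  \<comment> \<open>\<open>B\<close> bounds \<open>h\<close> on \<open>{0..3}\<close>, in particular
    at 2, from where \<open>far\<close> reaches all larger arguments.\<close>
  proof (rule that[of "B + 2 + \<bar>C0\<bar>"])
    fix x :: real assume x: "0 \<le> x"
    have "0 \<le> \<bar>C0\<bar> * x" using x by simp
    then have "\<bar>h x\<bar> \<le> B + 2 + \<bar>C0\<bar> * x"
      using B[OF x] B[of 2] far[of x] by (cases "x \<le> 3") linarith+
    also have "\<dots> \<le> (B + 2 + \<bar>C0\<bar>) * (1 + x)"
      using x B0 by (simp add: algebra_simps)
    finally show "\<bar>h x\<bar> \<le> (B + 2 + \<bar>C0\<bar>) * (1 + x)" .
  qed (use B0 in auto)
qed

section \<open>Moments of a solution\<close>

text \<open>For such \<open>h\<close> the quotient \<open>h x / (1 + x)\<close> is continuous and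
  bounded, hence an admissible test function for weak continuity in the weighted space.\<close>

definition linear_weight :: "(real \<Rightarrow> real) \<Rightarrow> bool" where
  "linear_weight h \<longleftrightarrow> continuous_on {0..} h \<and> (\<exists>C. \<forall>x\<ge>0. \<bar>h x\<bar> \<le> C * (1 + x))"

lemma linear_weightI:
  "continuous_on {0..} h \<Longrightarrow> (\<And>x. 0 \<le> x \<Longrightarrow> \<bar>h x\<bar> \<le> C * (1 + x)) \<Longrightarrow> linear_weight h"
  unfolding linear_weight_def by blast

lemma linear_weight_bounded:
  assumes "continuous_on {0..} h" and b: "\<And>x. 0 \<le> x \<Longrightarrow> \<bar>h x\<bar> \<le> B"
  shows "linear_weight h"
proof (rule linear_weightI[OF assms(1)])
  fix x :: real assume "0 \<le> x"
  then have "\<bar>h x\<bar> \<le> \<bar>B\<bar> * 1" using b by fastforce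
  also have "\<dots> \<le> \<bar>B\<bar> * (1 + x)" using \<open>0 \<le> x\<close> by (intro mult_left_mono) auto
  finally show "\<bar>h x\<bar> \<le> \<bar>B\<bar> * (1 + x)" .
qed

lemma linear_weight_const: "linear_weight (\<lambda>_. c)"
  by (rule linear_weight_bounded[of _ "\<bar>c\<bar>"]) auto

lemma linear_weight_id: "linear_weight (\<lambda>x. x)"
  by (rule linear_weightI[of _ 1]) auto

lemma linear_weight_mult_bounded:
  assumes "linear_weight h" "continuous_on {0..} g" "\<And>x. 0 \<le> x \<Longrightarrow> \<bar>g x\<bar> \<le> B"
  shows "linear_weight (\<lambda>x. h x * g x)"
proof -
  from assms(1) obtain C where h: "continuous_on {0..} h" and C: "\<And>x. 0 \<le> x \<Longrightarrow> \<bar>h x\<bar> \<le> C * (1 + x)"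
    unfolding linear_weight_def by auto
  show ?thesis
  proof (rule linear_weightI[of _ "C * B"])
    show "continuous_on {0..} (\<lambda>x. h x * g x)" using h assms(2) by (intro continuous_intros)
    fix x :: real assume x: "0 \<le> x"
    have "\<bar>h x\<bar> * \<bar>g x\<bar> \<le> C * (1 + x) * B"
      using C[OF x] assms(3)[OF x] by (intro mult_mono) auto
    then show "\<bar>h x * g x\<bar> \<le> C * B * (1 + x)" by (simp add: abs_mult mult_ac)
  qed
qed

lemma linear_weight_add:
  assumes "linear_weight h" "linear_weight k"
  shows "linear_weight (\<lambda>x. h x + k x)"
proof -
  from assms obtain C D where h: "continuous_on {0..} h" "continuous_on {0..} k"
    and C: "\<And>x. 0 \<le> x \<Longrightarrow> \<bar>h x\<bar> \<le> C * (1 + x)" "\<And>x. 0 \<le> x \<Longrightarrow> \<bar>k x\<bar> \<le> D * (1 + x)"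
    unfolding linear_weight_def by auto
  show ?thesis
  proof (rule linear_weightI[of _ "C + D"])
    show "continuous_on {0..} (\<lambda>x. h x + k x)" using h by (intro continuous_intros)
    fix x :: real assume x: "0 \<le> x"
    show "\<bar>h x + k x\<bar> \<le> (C + D) * (1 + x)"
      using C[OF x] abs_triangle_ineq[of "h x" "k x"] by (simp add: distrib_right)
  qed
qed

lemma linear_weight_cmult: "linear_weight h \<Longrightarrow> linear_weight (\<lambda>x. c * h x)"
  using linear_weight_mult_bounded[of h "\<lambda>_. c" "\<bar>c\<bar>"] by (simp add: mult.commute)

lemma linear_weight_diff:
  "linear_weight h \<Longrightarrow> linear_weight k \<Longrightarrow> linear_weight (\<lambda>x. h x - k x)"
  using linear_weight_add[of h "\<lambda>x. -1 * k x"] linear_weight_cmult[of k "-1"] by simp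

lemmas linear_weight_intros =
  linear_weight_const linear_weight_id linear_weight_add linear_weight_diff linear_weight_cmult

lemma continuous_on_imp_Linfty:
  assumes "continuous_on {0..} h" and "\<And>x. 0 \<le> x \<Longrightarrow> \<bar>h x\<bar> \<le> B"
  shows "h \<in> Linfty {0<..}"
proof -
  have "set_borel_measurable lborel {0<..} h"
    unfolding set_borel_measurable_def
    using borel_measurable_continuous_on_indicator[of "{0<..}" h]
      continuous_on_subset[OF assms(1), of "{0<..}"] by (simp add: subset_eq)
  moreover have "AE x\<in>{0<..} in lborel. \<bar>h x\<bar> \<le> B" using assms(2) by (intro AE_I2) auto
  ultimately show ?thesis unfolding Linfty_def by blast
qed

text \<open>Hypothesis (ii) enters here as linear growth of \<open>a\<close> and \<open>b\<close>,
  which makes the drift an admissible weight at each time.\<close>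

locale nucleation_solution =
  fixes a b nuc fin :: "real \<Rightarrow> real" and f :: "real \<Rightarrow> real \<Rightarrow> real"
    and \<Phi>0 \<rho> :: real
  assumes a_weight: "linear_weight a" and a_pos: "\<And>x. 0 < x \<Longrightarrow> 0 < a x"
    and b_weight: "linear_weight b"
    and nuc_cont: "continuous_on {0..} nuc" and nuc_nonneg: "\<And>z. 0 \<le> z \<Longrightarrow> 0 \<le> nuc z"
    and Phi_lim: "((\<lambda>x. b x / a x) \<longlongrightarrow> \<Phi>0) (at_right 0)" and Phi0_nonneg: "0 \<le> \<Phi>0"
    and Phi_mono: "strict_mono_on {0..} (Phi a b \<Phi>0)"
    and a_inf: "0 < (INF x\<in>{1<..}. a x)"
    and inv_a_int: "set_integrable lborel {0<..<1} (\<lambda>x. 1 / a x)"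
    and nuc_ge: "\<exists>c>0. \<exists>k0\<ge>1. \<forall>z\<ge>0. nuc z \<ge> c * z powr k0"
    and sol: "LS_global_solution a b nuc \<Phi>0 \<rho> fin f"
begin

abbreviation u where "u \<equiv> monomer \<rho> f"

definition mom :: "(real \<Rightarrow> real) \<Rightarrow> real \<Rightarrow> real" where
  "mom h t = (LBINT x:{0<..}. h x * f t x)"

lemma f_nonneg: "0 \<le> t \<Longrightarrow> AE x\<in>{0<..} in lborel. 0 \<le> f t x"
  and f_cont: "weakly_continuous_L1 f"
  and u_gt: "0 \<le> t \<Longrightarrow> \<Phi>0 < u t"
  using sol unfolding LS_global_solution_def by auto

lemma u_eq: "u t = \<rho> - mom (\<lambda>x. x) t"
  by (simp add: monomer_def mom_def)

lemma moment0_eq: "moment0 f t = mom (\<lambda>_. 1) t"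
  by (simp add: moment0_def mom_def)

lemma f_L1: "0 \<le> t \<Longrightarrow> set_integrable lborel {0<..} (\<lambda>x. f t x * (1 + x))"
  using f_cont unfolding weakly_continuous_L1_def L1_weighted_def by auto

lemma mom_integrable:
  assumes "0 \<le> t" "linear_weight h"
  shows "set_integrable lborel {0<..} (\<lambda>x. h x * f t x)"
proof -
  from assms(2) obtain C where h: "continuous_on {0..} h" and C: "\<And>x. 0 \<le> x \<Longrightarrow> \<bar>h x\<bar> \<le> C * (1 + x)"
    unfolding linear_weight_def by auto
  have "continuous_on {0<..} (\<lambda>x. h x / (1 + x))"
    by (auto intro!: continuous_intros continuous_on_subset[OF h])
  then have m1: "(\<lambda>x. indicator {0<..} x *\<^sub>R (h x / (1 + x))) \<in> borel_measurable lborel"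
    using borel_measurable_continuous_on_indicator[of "{0<..}" "\<lambda>x. h x / (1 + x)"] by simp
  have m2: "(\<lambda>x. indicator {0<..} x *\<^sub>R (f t x * (1 + x))) \<in> borel_measurable lborel"
    using f_L1[OF assms(1)] unfolding set_integrable_def by (rule borel_measurable_integrable)
  \<comment> \<open>Measurability is given for \<open>f t x * (1 + x)\<close> on the half-line, so
    \<open>h x * f t x\<close> is written as a product of two functions known to be
    measurable.\<close>
  have "(\<lambda>x. (indicator {0<..} x *\<^sub>R (h x / (1 + x))) * (indicator {0<..} x *\<^sub>R (f t x * (1 + x))))
      \<in> borel_measurable lborel"
    by (intro borel_measurable_times m1 m2)
  also have "(\<lambda>x. (indicator {0<..} x *\<^sub>R (h x / (1 + x))) * (indicator {0<..} x *\<^sub>R (f t x * (1 + x))))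
     = (\<lambda>x. indicator {0<..} x *\<^sub>R (h x * f t x))"
    by (rule ext) (auto simp: indicator_def)
  finally have m: "set_borel_measurable lborel {0<..} (\<lambda>x. h x * f t x)"
    unfolding set_borel_measurable_def .
  show ?thesis
  proof (rule set_integrable_bound[OF _ m])
    show "set_integrable lborel {0<..} (\<lambda>x. C * (f t x * (1 + x)))"
      using f_L1[OF assms(1)] by (rule set_integrable_mult_right)
    show "AE x in lborel. x \<in> {0<..} \<longrightarrow> norm (h x * f t x) \<le> norm (C * (f t x * (1 + x)))"
    proof (intro AE_I2 impI)
      fix x :: real assume "x \<in> {0<..}"
      then have "\<bar>h x\<bar> \<le> \<bar>C * (1 + x)\<bar>" using C[of x] by auto
      then have "\<bar>h x\<bar> * \<bar>f t x\<bar> \<le> \<bar>C * (1 + x)\<bar> * \<bar>f t x\<bar>" by (intro mult_right_mono) auto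
      then show "norm (h x * f t x) \<le> norm (C * (f t x * (1 + x)))"
        by (simp add: abs_mult mult_ac)
    qed
  qed
qed

text \<open>This is weak continuity tested with \<open>h x / (1 + x)\<close>.\<close>

lemma mom_continuous:
  assumes "linear_weight h"
  shows "continuous_on {0..} (mom h)"
proof -
  from assms obtain C where h: "continuous_on {0..} h" and C: "\<And>x. 0 \<le> x \<Longrightarrow> \<bar>h x\<bar> \<le> C * (1 + x)"
    unfolding linear_weight_def by auto
  have "(\<lambda>x. h x / (1 + x)) \<in> Linfty {0<..}"
  proof (rule continuous_on_imp_Linfty)
    show "continuous_on {0..} (\<lambda>x. h x / (1 + x))" by (auto intro!: continuous_intros h)
    show "\<bar>h x / (1 + x)\<bar> \<le> C" if "0 \<le> x" for x
      using C[OF that] that by (simp add: field_simps)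
  qed
  then have "continuous_on {0..} (\<lambda>t. LBINT x:{0<..}. f t x * (h x / (1 + x)) * (1 + x))"
    by (rule f_cont[unfolded weakly_continuous_L1_def, THEN conjunct2, rule_format])
  moreover have "(LBINT x:{0<..}. f t x * (h x / (1 + x)) * (1 + x)) = mom h t" for t
    unfolding mom_def by (rule set_lebesgue_integral_cong) auto
  ultimately show ?thesis by simp
qed

lemma mom_mono:
  assumes "0 \<le> t" "linear_weight h" "linear_weight k" "\<And>x. 0 < x \<Longrightarrow> h x \<le> k x"
  shows "mom h t \<le> mom k t"
  unfolding mom_def
proof (rule set_integral_mono_AE)
  show "AE x\<in>{0<..} in lborel. h x * f t x \<le> k x * f t x"
    using f_nonneg[OF assms(1)] by eventually_elim (auto intro: mult_right_mono assms(4))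
qed (use assms mom_integrable in auto)

lemma mom_add:
  "0 \<le> t \<Longrightarrow> linear_weight h \<Longrightarrow> linear_weight k \<Longrightarrow> mom (\<lambda>x. h x + k x) t = mom h t + mom k t"
  unfolding mom_def using mom_integrable by (simp add: distrib_right)

lemma mom_diff:
  "0 \<le> t \<Longrightarrow> linear_weight h \<Longrightarrow> linear_weight k \<Longrightarrow> mom (\<lambda>x. h x - k x) t = mom h t - mom k t"
  unfolding mom_def using mom_integrable by (simp add: left_diff_distrib)

lemma mom_cmult: "mom (\<lambda>x. c * h x) t = c * mom h t"
  unfolding mom_def by (simp add: mult.assoc)

lemma mom_nonneg:
  "0 \<le> t \<Longrightarrow> linear_weight h \<Longrightarrow> (\<And>x. 0 < x \<Longrightarrow> 0 \<le> h x) \<Longrightarrow> 0 \<le> mom h t"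
  using mom_mono[of t "\<lambda>_. 0" h] linear_weight_const by (simp add: mom_def)

lemma u_le: "0 \<le> t \<Longrightarrow> u t \<le> \<rho>"
  using mom_nonneg[of t "\<lambda>x. x"] by (simp add: u_eq linear_weight_id)

lemma u_nonneg: "0 \<le> t \<Longrightarrow> 0 \<le> u t"
  using u_gt[of t] Phi0_nonneg by simp

lemma mom_id_le: "0 \<le> t \<Longrightarrow> mom (\<lambda>x. x) t \<le> \<rho>"
  using u_nonneg[of t] by (simp add: u_eq)

lemma u_continuous: "continuous_on {0..} u"
  unfolding u_eq by (intro continuous_intros mom_continuous linear_weight_id)

lemma nuc_u_continuous: "continuous_on {0..} (\<lambda>r. nuc (u r))"
  using u_nonneg by (intro continuous_on_compose2[OF nuc_cont u_continuous]) auto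

text \<open>For \<open>g = \<phi>'\<close> and \<open>c = \<phi> 0\<close> this is the time
  derivative of the moment of \<open>\<phi>\<close>: drift of existing particles plus nucleation at
  size 0.\<close>

definition flux :: "real \<Rightarrow> (real \<Rightarrow> real) \<Rightarrow> real \<Rightarrow> real" where
  "flux c g r = mom (\<lambda>x. (a x * u r - b x) * g x) r + c * nuc (u r)"

lemma flux_weight:
  assumes "continuous_on {0..} g" "\<And>x. 0 \<le> x \<Longrightarrow> \<bar>g x\<bar> \<le> B"
  shows "linear_weight (\<lambda>x. (a x * u r - b x) * g x)"
proof -
  have "linear_weight (\<lambda>x. u r * a x - b x)"
    by (intro linear_weight_intros a_weight b_weight)
  then show ?thesis
    using linear_weight_mult_bounded[OF _ assms, of "\<lambda>x. u r * a x - b x"]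
    by (simp add: mult.commute[of "u r"])
qed

text \<open>The weight varies in time through \<open>u r\<close>, so continuity of moments does not
  apply directly. It is affine in \<open>u r\<close>, which leaves two moments with fixed
  weights.\<close>

lemma flux_continuous:
  assumes "continuous_on {0..} g" "\<And>x. 0 \<le> x \<Longrightarrow> \<bar>g x\<bar> \<le> B"
  shows "continuous_on {0..} (flux c g)"
proof -
  note wa = linear_weight_mult_bounded[OF a_weight assms]
  note wb = linear_weight_mult_bounded[OF b_weight assms]
  have "flux c g r = u r * mom (\<lambda>x. a x * g x) r - mom (\<lambda>x. b x * g x) r + c * nuc (u r)"
    if "0 \<le> r" for r
  proof -
    have "mom (\<lambda>x. (a x * u r - b x) * g x) r = mom (\<lambda>x. u r * (a x * g x) - b x * g x) r"
      by (rule arg_cong[where f = "\<lambda>h. mom h r"]) (auto simp: algebra_simps)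
    then show ?thesis
      using that wa wb by (simp add: flux_def mom_diff linear_weight_cmult mom_cmult)
  qed
  then have "continuous_on {0..} (flux c g) \<longleftrightarrow> continuous_on {0..}
      (\<lambda>r. u r * mom (\<lambda>x. a x * g x) r - mom (\<lambda>x. b x * g x) r + c * nuc (u r))"
    by (intro continuous_on_cong) auto
  then show ?thesis
    using wa wb by (simp, intro continuous_intros mom_continuous u_continuous nuc_u_continuous)
qed

text \<open>Subtracting the weak formulations at the two times removes the initial data; continuity
  in time turns the Lebesgue integrals over time into gauge integrals.\<close>

lemma transport:
  assumes \<phi>: "continuous_on {0..} \<phi>" "\<And>x. 0 < x \<Longrightarrow> (\<phi> has_real_derivative g x) (at x)"
    and g: "continuous_on {0..} g" "\<And>x. 0 \<le> x \<Longrightarrow> \<bar>g x\<bar> \<le> B"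
    and st: "0 \<le> s" "s \<le> t"
  shows "mom \<phi> t - mom \<phi> s = integral {s..t} (flux (\<phi> 0) g)"
proof -
  have wd: "weak_derivative_on \<phi> g {0<..}"
    using \<phi> g(1) by (intro weak_derivative_onI) (auto elim: continuous_on_subset)
  have c: "continuous_on {0..t} (flux (\<phi> 0) g)" for t
    using flux_continuous[OF g] by (rule continuous_on_subset) auto
  have *: "mom \<phi> t = (LBINT x:{0<..}. \<phi> x * fin x) + integral {0..t} (flux (\<phi> 0) g)"
    if "0 \<le> t" for t
  proof -
    let ?J = "\<lambda>s. LBINT x:{0<..}. (a x * u s - b x) * g x * f s x"
    have J: "?J s = mom (\<lambda>x. (a x * u s - b x) * g x) s" for s by (simp add: mom_def)
    have c1: "continuous_on {0..t} ?J"
      using c[of t] continuous_on_subset[OF flux_continuous[OF g, of 0], of "{0..t}"]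
      by (simp add: J flux_def)
    have c2: "continuous_on {0..t} (\<lambda>s. \<phi> 0 * nuc (u s))"
      by (intro continuous_intros continuous_on_subset[OF nuc_u_continuous]) auto
    have "mom \<phi> t = (LBINT x:{0<..}. \<phi> x * fin x) + (LBINT s:{0..t}. ?J s)
       + (LBINT s:{0..t}. \<phi> 0 * nuc (u s))"
      using sol \<phi>(1) continuous_on_imp_Linfty[OF g] wd that
      unfolding LS_global_solution_def mom_def by blast
    also have "(LBINT s:{0..t}. ?J s) = integral {0..t} ?J"
      using borel_integrable_atLeastAtMost'[OF c1] by (rule set_borel_integral_eq_integral)
    also have "(LBINT s:{0..t}. \<phi> 0 * nuc (u s)) = integral {0..t} (\<lambda>s. \<phi> 0 * nuc (u s))"
      using borel_integrable_atLeastAtMost'[OF c2] by (rule set_borel_integral_eq_integral)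
    also have "(LBINT x:{0<..}. \<phi> x * fin x) + integral {0..t} ?J + integral {0..t} (\<lambda>s. \<phi> 0 * nuc (u s))
      = (LBINT x:{0<..}. \<phi> x * fin x) + integral {0..t} (\<lambda>s. ?J s + \<phi> 0 * nuc (u s))"
      using integrable_continuous_real[OF c1] integrable_continuous_real[OF c2]
      by (simp add: Henstock_Kurzweil_Integration.integral_add)
    finally show ?thesis by (simp add: J flux_def[abs_def])
  qed
  have "integral {0..s} (flux (\<phi> 0) g) + integral {s..t} (flux (\<phi> 0) g) = integral {0..t} (flux (\<phi> 0) g)"
    using st c by (intro Henstock_Kurzweil_Integration.integral_combine integrable_continuous_real) auto
  then show ?thesis using *[of s] *[of t] st by simp
qed

lemma transport_le:
  assumes \<phi>: "continuous_on {0..} \<phi>" "\<And>x. 0 < x \<Longrightarrow> (\<phi> has_real_derivative g x) (at x)"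
    and g: "continuous_on {0..} g" "\<And>x. 0 \<le> x \<Longrightarrow> \<bar>g x\<bar> \<le> B"
    and st: "0 \<le> s" "s \<le> t"
    and le: "\<And>r. s \<le> r \<Longrightarrow> r \<le> t \<Longrightarrow> flux (\<phi> 0) g r \<le> c"
  shows "mom \<phi> t - mom \<phi> s \<le> c * (t - s)"
proof -
  have "mom \<phi> t - mom \<phi> s = integral {s..t} (flux (\<phi> 0) g)"
    by (rule transport[OF \<phi> g st])
  also have "\<dots> \<le> integral {s..t} (\<lambda>_. c)"
    using st le continuous_on_subset[OF flux_continuous[OF g], of "{s..t}"]
    by (intro integral_le integrable_continuous_real) auto
  also have "\<dots> = c * (t - s)" using st by simp
  finally show ?thesis .
qed

text \<open>The test function 1 has zero derivative, so only the nucleation term remains.\<close>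

lemma mom_diff_nuc:
  assumes "0 \<le> s" "s \<le> t"
  shows "moment0 f t - moment0 f s = integral {s..t} (\<lambda>r. nuc (u r))"
  using transport[of "\<lambda>_. 1" "\<lambda>_. 0" 0 s t] assms
  by (simp add: moment0_eq flux_def[abs_def] mom_def)

lemma moment0_mono: "0 \<le> s \<Longrightarrow> s \<le> t \<Longrightarrow> moment0 f s \<le> moment0 f t"
proof -
  assume st: "0 \<le> s" "s \<le> t"
  have "0 \<le> integral {s..t} (\<lambda>r. nuc (u r))"
    using st continuous_on_subset[OF nuc_u_continuous, of "{s..t}"] nuc_nonneg u_nonneg
    by (intro integral_nonneg integrable_continuous_real) auto
  then show ?thesis using mom_diff_nuc[OF st] by simp
qed

end

section \<open>Convergence of the monomer concentration\<close>

text \<open>A linear ramp from 0 at \<open>p\<close> to 1 at \<open>2 * p\<close>.\<close>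

definition cutoff :: "real \<Rightarrow> real \<Rightarrow> real" where
  "cutoff p x = (max 0 (x - p) - max 0 (x - 2 * p)) / p"

text \<open>The antiderivative of \<open>cutoff p\<close> that vanishes up to \<open>p\<close>;
  beyond \<open>2 * p\<close> it equals \<open>x - 3 * p / 2\<close>. As a test function it measures
  the mass in large sizes, and nucleation does not contribute because it vanishes at 0.\<close>

definition tail :: "real \<Rightarrow> real \<Rightarrow> real" where
  "tail p x = ((max 0 (x - p))\<^sup>2 - (max 0 (x - 2 * p))\<^sup>2) / (2 * p)"

lemma continuous_on_cutoff: "0 < p \<Longrightarrow> continuous_on S (cutoff p)"
  unfolding cutoff_def by (intro continuous_intros) auto

lemma cutoff_nonneg: "0 < p \<Longrightarrow> 0 \<le> cutoff p x"
  by (simp add: cutoff_def max_def)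

lemma cutoff_le_1: "0 < p \<Longrightarrow> cutoff p x \<le> 1"
  by (simp add: cutoff_def max_def field_simps)

lemma cutoff_eq_0: "x \<le> p \<Longrightarrow> 0 < p \<Longrightarrow> cutoff p x = 0"
  by (simp add: cutoff_def)

lemma cutoff_eq_1: "2 * p \<le> x \<Longrightarrow> 0 < p \<Longrightarrow> cutoff p x = 1"
  by (simp add: cutoff_def field_simps)

lemma cutoff_le: "0 < p \<Longrightarrow> 0 \<le> x \<Longrightarrow> cutoff p x \<le> x / p"
  by (simp add: cutoff_def max_def field_simps)

lemma has_real_derivative_tail:
  assumes "0 < p"
  shows "(tail p has_real_derivative cutoff p x) (at x)"
proof -
  have 1: "((\<lambda>z. (max 0 (z - c))\<^sup>2) has_real_derivative 2 * max 0 (x - c)) (at x)" for c :: real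
    using DERIV_shift[of "\<lambda>z. (max 0 z)\<^sup>2" "2 * max 0 (x - c)" x "-c"]
      has_real_derivative_pos_part_square[of "x - c"] by simp
  show ?thesis unfolding tail_def cutoff_def
    by (rule DERIV_cong, rule DERIV_cdivide, rule DERIV_diff[OF 1[of p] 1[of "2 * p"]])
       (use assms in \<open>simp add: field_simps\<close>)
qed

lemma continuous_on_tail: "0 < p \<Longrightarrow> continuous_on S (tail p)"
  unfolding tail_def by (intro continuous_intros) auto

lemma tail_eq_0: "x \<le> p \<Longrightarrow> 0 < p \<Longrightarrow> tail p x = 0"
  by (simp add: tail_def)

lemma tail_eq: "2 * p \<le> x \<Longrightarrow> 0 < p \<Longrightarrow> tail p x = x - 3 * p / 2"
  by (simp add: tail_def field_simps power2_eq_square)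

lemma tail_nonneg: 
  assumes "0 < p"
  shows "0 \<le> tail p x"
proof -
  have "(max 0 (x - 2 * p))\<^sup>2 \<le> (max 0 (x - p))\<^sup>2"
    using assms by (intro power_mono) auto
  then show ?thesis using assms by (simp add: tail_def)
qed

lemma tail_le: 
  assumes "0 < p" "0 \<le> x"
  shows "tail p x \<le> x"
proof -
  consider "x \<le> p" | "p \<le> x" "x \<le> 2 * p" | "2 * p \<le> x" by linarith
  then show ?thesis
  proof cases
    case 2
    have "(x - p)\<^sup>2 \<le> x * p"
      using 2 mult_mono[of "x - p" x "x - p" p] by (simp add: power2_eq_square)
    also have "\<dots> \<le> x * (2 * p)" using assms by simp
    finally show ?thesis using 2 assms by (simp add: tail_def field_simps)
  qed (use assms in \<open>auto simp: tail_eq_0 tail_eq\<close>)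
qed

lemma linear_weight_cutoff: "0 < p \<Longrightarrow> linear_weight (cutoff p)"
  by (rule linear_weight_bounded[of _ 1]) (auto simp: continuous_on_cutoff cutoff_nonneg cutoff_le_1)

lemma linear_weight_tail: 
  assumes "0 < p" shows "linear_weight (tail p)"
proof (rule linear_weightI[of _ 1])
  fix x :: real assume "0 \<le> x"
  then show "\<bar>tail p x\<bar> \<le> 1 * (1 + x)"
    using tail_le[OF assms] tail_nonneg[OF assms, of x] by fastforce
qed (rule continuous_on_tail[OF assms])

lemma ex_antiderivative:
  fixes g :: "real \<Rightarrow> real"
  assumes "continuous_on {0..} g"
  obtains \<phi> where "continuous_on {0..} \<phi>" "\<And>x. 0 < x \<Longrightarrow> (\<phi> has_real_derivative g x) (at x)"
    "\<And>x. 0 \<le> x \<Longrightarrow> \<phi> x = (LBINT z:{0..x}. g z)" "\<phi> 0 = 0"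
proof -
  \<comment> \<open>Constant extension to the left, with base point -1 for the integral, makes 0 an
    interior point, so continuity at 0 follows from differentiability there.\<close>
  define h where "h x = g (max 0 x)" for x
  have h: "continuous_on S h" for S
    unfolding h_def by (intro continuous_on_compose2[OF assms] continuous_intros) auto
  define \<phi> where "\<phi> x = integral {-1..x} h - integral {-1..0} h" for x
  have d: "(\<phi> has_real_derivative h x) (at x)" if "-1 < x" for x
  proof -
    have "((\<lambda>x. integral {-1..x} h) has_real_derivative h x) (at x within {-1..x+1})"
      using that by (intro integral_has_real_derivative h) auto
    moreover have "at x within {-1..x+1} = at x"
      using that by (intro at_within_interior) auto
    ultimately have "((\<lambda>x. integral {-1..x} h) has_real_derivative h x) (at x)" by simp
    then show ?thesis unfolding \<phi>_def by (auto intro!: derivative_eq_intros)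
  qed
  show ?thesis
  proof (rule that)
    show "continuous_on {0..} \<phi>"
      by (intro continuous_at_imp_continuous_on ballI DERIV_isCont[OF d]) auto
    show "(\<phi> has_real_derivative g x) (at x)" if "0 < x" for x
      using d[of x] that by (simp add: h_def)
    show "\<phi> x = (LBINT z:{0..x}. g z)" if x: "0 \<le> x" for x
    proof -
      have "integral {-1..0} h + integral {0..x} h = integral {-1..x} h"
        using x by (intro Henstock_Kurzweil_Integration.integral_combine integrable_continuous_real h) auto
      moreover have "integral {0..x} h = integral {0..x} g"
        by (intro Henstock_Kurzweil_Integration.integral_cong) (auto simp: h_def)
      moreover have "(LBINT z:{0..x}. g z) = integral {0..x} g"
        by (intro set_borel_integral_eq_integral borel_integrable_atLeastAtMost'
              continuous_on_subset[OF assms]) auto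
      ultimately show ?thesis by (simp add: \<phi>_def)
    qed
    show "\<phi> 0 = 0" by (simp add: \<phi>_def)
  qed
qed

section \<open>Growth rates of \<open>u\<close> and of the number of particles\<close>

context nucleation_solution
begin

abbreviation \<Phi> where "\<Phi> \<equiv> Phi a b \<Phi>0"

lemma b_eq: "0 < x \<Longrightarrow> b x = a x * \<Phi> x"
  using a_pos[of x] by (simp add: Phi_def)

lemma drift_eq: "0 < x \<Longrightarrow> a x * v - b x = a x * (v - \<Phi> x)"
  by (simp add: b_eq right_diff_distrib)

lemma Phi_near_0:
  assumes "0 < e"
  obtains \<eta> where "0 < \<eta>" "\<And>x. 0 < x \<Longrightarrow> x < \<eta> \<Longrightarrow> \<Phi> x \<le> \<Phi>0 + e"
proof -
  have "\<forall>\<^sub>F x in at_right 0. b x / a x < \<Phi>0 + e"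
    using order_tendstoD(2)[OF Phi_lim, of "\<Phi>0 + e"] assms by simp
  then obtain \<eta> where "0 < \<eta>" "\<forall>y>0. y < \<eta> \<longrightarrow> b y / a y < \<Phi>0 + e"
    unfolding eventually_at_right_field by auto
  then show ?thesis by (intro that[of \<eta>]) (auto simp: Phi_def less_imp_le)
qed

lemma rho_nonneg: "0 \<le> \<rho>"
  using u_le[of 0] u_nonneg[of 0] by simp

text \<open>Sizes below \<open>\<eta>\<close> satisfy \<open>\<Phi> x \<le> u r\<close> and do not
  shrink. Monomers are returned only by sizes \<open>x \<ge> \<eta>\<close>, at a rate of at most
  \<open>b x \<le> K * (1 + x) \<le> C * x\<close>; the bound \<open>\<rho>\<close> on the first
  moment then limits the total.\<close>

lemma u_rise:
  assumes "0 < \<delta>"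
  obtains C where "0 < C" "\<And>s t. 0 \<le> s \<Longrightarrow> s \<le> t \<Longrightarrow> (\<forall>r\<in>{s..t}. \<Phi>0 + \<delta> \<le> u r)
     \<Longrightarrow> u t - u s \<le> C * (t - s)"
proof -
  obtain \<eta> where \<eta>: "0 < \<eta>" "\<And>x. 0 < x \<Longrightarrow> x < \<eta> \<Longrightarrow> \<Phi> x \<le> \<Phi>0 + \<delta>" using Phi_near_0[OF assms] by blast
  obtain K where K: "\<And>x. 0 \<le> x \<Longrightarrow> \<bar>b x\<bar> \<le> K * (1 + x)"
    using b_weight unfolding linear_weight_def by auto
  have K0: "0 \<le> K" using K[of 0] by simp
  define C where "C = K * (1 / \<eta> + 1)"
  have C0: "0 \<le> C" using K0 \<eta> by (simp add: C_def)
  have pt: "(a x * v - b x) * (- 1) \<le> C * x" if x: "0 < x" and v: "\<Phi>0 + \<delta> \<le> v" for x v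
  proof (cases "x < \<eta>")
    case True
    then have "\<Phi> x \<le> v" using \<eta>(2)[OF x] v by simp
    then have "0 \<le> a x * (v - \<Phi> x)" using a_pos[OF x] by simp
    then have "(a x * v - b x) * (-1) \<le> 0" using drift_eq[OF x, of v] by simp
    then show ?thesis using mult_nonneg_nonneg[OF C0, of x] x by linarith
  next
    case False
    have "0 \<le> a x * v" using a_pos[OF x] v Phi0_nonneg assms by simp
    then have "(a x * v - b x) * (-1) \<le> K * (1 + x)" using abs_le_D1[OF K[of x]] x by (simp add: algebra_simps)
    also have "\<dots> \<le> K * ((1 / \<eta> + 1) * x)"
      using False \<eta> by (intro mult_left_mono K0) (simp add: field_simps)
    finally show ?thesis by (simp add: C_def mult.assoc)
  qed
  show ?thesis
  proof (rule that[of "C * \<rho> + 1"])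
    \<comment> \<open>The added 1 makes the rate strictly positive; it is divided by when the window
      length is chosen.\<close>
    show "0 < C * \<rho> + 1" using mult_nonneg_nonneg[OF C0 rho_nonneg] by simp
    fix s t assume st: "0 \<le> s" "s \<le> t" and r: "\<forall>r\<in>{s..t}. \<Phi>0 + \<delta> \<le> u r"
    have m: "mom (\<lambda>x. - x) r = - mom (\<lambda>x. x) r" for r
      using mom_cmult[of "-1" "\<lambda>x. x" r] by simp
    have "mom (\<lambda>x. - x) t - mom (\<lambda>x. - x) s \<le> (C * \<rho> + 1) * (t - s)"
    proof (rule transport_le[where g = "\<lambda>_. -1" and B = 1])
      fix q assume q: "s \<le> q" "q \<le> t"
      have "mom (\<lambda>x. (a x * u q - b x) * (- 1)) q \<le> mom (\<lambda>x. C * x) q"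
        using q st r by (intro mom_mono pt flux_weight linear_weight_intros) auto
      also have "\<dots> \<le> C * \<rho>"
        using q st C0 by (simp add: mom_cmult mom_id_le mult_left_mono)
      finally show "flux (- 0) (\<lambda>_. - 1) q \<le> C * \<rho> + 1" by (simp add: flux_def)
    qed (use st in \<open>auto intro!: continuous_intros derivative_eq_intros\<close>)
    then show "u t - u s \<le> (C * \<rho> + 1) * (t - s)" by (simp add: u_eq m)
  qed
qed

text \<open>By \<open>u_rise\<close>, climbing from \<open>\<Phi>0 + \<delta>\<close> to
  \<open>\<Phi>0 + 2 * \<delta>\<close> takes at least the time \<open>\<delta> / C\<close>; half of
  that time is taken as the window.\<close>

lemma u_window:
  assumes "0 < \<delta>"
  obtains \<tau> where "0 < \<tau>" "\<And>t r. \<tau> \<le> t \<Longrightarrow> \<Phi>0 + 2 * \<delta> \<le> u t \<Longrightarrow> t - \<tau> \<le> r \<Longrightarrow> r \<le> t \<Longrightarrow> \<Phi>0 + \<delta> \<le> u r"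
proof -
  obtain C where C: "0 < C" "\<And>s t. 0 \<le> s \<Longrightarrow> s \<le> t \<Longrightarrow> (\<forall>r\<in>{s..t}. \<Phi>0 + \<delta> \<le> u r)
     \<Longrightarrow> u t - u s \<le> C * (t - s)" using u_rise[OF assms] by blast
  define \<tau> where "\<tau> = \<delta> / (2 * C)"
  show ?thesis
  proof (rule that[of \<tau>])
    show "0 < \<tau>" using assms C by (simp add: \<tau>_def)
    fix t r assume t: "\<tau> \<le> t" "\<Phi>0 + 2 * \<delta> \<le> u t" and r: "t - \<tau> \<le> r" "r \<le> t"
    show "\<Phi>0 + \<delta> \<le> u r"
    proof (rule ccontr)
      assume "\<not> \<Phi>0 + \<delta> \<le> u r"
      \<comment> \<open>Its largest element is the last time at or below the level
        \<open>\<Phi>0 + \<delta>\<close>. The intermediate value theorem gives equality there, and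
        from then on \<open>u_rise\<close> applies.\<close>
      define S where "S = {q \<in> {r..t}. u q \<le> \<Phi>0 + \<delta>}"
      have c: "continuous_on {q..t} u" if "0 \<le> q" for q
        using that by (intro continuous_on_subset[OF u_continuous]) auto
      have "closed S" unfolding S_def
        using r t c[of r] by (intro continuous_closed_preimage_constant continuous_on_closed_Collect_le continuous_intros) auto
      moreover have "bounded S" unfolding S_def
        by (rule bounded_subset[OF bounded_closed_interval[of r t]]) auto
      ultimately have "compact S" by (simp add: compact_eq_bounded_closed)
      moreover have "S \<noteq> {}" using \<open>\<not> \<Phi>0 + \<delta> \<le> u r\<close> r by (auto simp: S_def)
      ultimately obtain q where q: "q \<in> S" and max: "\<And>p. p \<in> S \<Longrightarrow> p \<le> q"
        using compact_attains_sup[of S] by blast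
      have q': "r \<le> q" "q \<le> t" "u q \<le> \<Phi>0 + \<delta>" using q by (auto simp: S_def)
      have "\<exists>p\<ge>q. p \<le> t \<and> u p = \<Phi>0 + \<delta>"
        using q' t assms r c[of q] by (intro IVT') auto
      then obtain p where p: "q \<le> p" "p \<le> t" "u p = \<Phi>0 + \<delta>" by blast
      then have "p = q" using max[of p] q' by (auto simp: S_def)
      then have uq: "u q = \<Phi>0 + \<delta>" using p by simp
      have "u t - u q \<le> C * (t - q)"
      proof (rule C(2))
        show "\<forall>z\<in>{q..t}. \<Phi>0 + \<delta> \<le> u z"
        proof
          fix z assume z: "z \<in> {q..t}"
          show "\<Phi>0 + \<delta> \<le> u z"
          proof (rule ccontr)
            assume "\<not> \<Phi>0 + \<delta> \<le> u z"
            then have "z \<in> S" using z q' by (simp add: S_def)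
            then have "z = q" using max[of z] z by simp
            then show False using \<open>\<not> \<Phi>0 + \<delta> \<le> u z\<close> uq by simp
          qed
        qed
      qed (use q' r t in auto)
      also have "\<dots> \<le> C * \<tau>" using C(1) q' r by (intro mult_left_mono) auto
      also have "\<dots> = \<delta> / 2" using C(1) by (simp add: \<tau>_def)
      finally show False using uq t assms by simp
    qed
  qed
qed

text \<open>Since \<open>0 \<le> \<Phi>0\<close>, such times have \<open>\<delta> \<le> u r\<close>,
  and (v) bounds the nucleation rate below by \<open>c * \<delta> powr k0\<close>.\<close>

lemma moment0_increment_ge:
  assumes "0 < \<delta>"
  obtains m where "0 < m" "\<And>s t. 0 \<le> s \<Longrightarrow> s \<le> t \<Longrightarrow> (\<forall>r\<in>{s..t}. \<Phi>0 + \<delta> \<le> u r)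
     \<Longrightarrow> m * (t - s) \<le> moment0 f t - moment0 f s"
proof -
  obtain c k0 where c: "0 < c" "1 \<le> k0" "\<And>z. 0 \<le> z \<Longrightarrow> c * z powr k0 \<le> nuc z" using nuc_ge by auto
  show ?thesis
  proof (rule that[of "c * \<delta> powr k0"])
    show "0 < c * \<delta> powr k0" using c assms by simp
    fix s t assume st: "0 \<le> s" "s \<le> t" and r: "\<forall>r\<in>{s..t}. \<Phi>0 + \<delta> \<le> u r"
    have "integral {s..t} (\<lambda>_. c * \<delta> powr k0) \<le> integral {s..t} (\<lambda>r. nuc (u r))"
    proof (rule integral_le)
      show "(\<lambda>r. nuc (u r)) integrable_on {s..t}"
        using st by (intro integrable_continuous_real continuous_on_subset[OF nuc_u_continuous]) auto
      fix q assume "q \<in> {s..t}"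
      then have "\<delta> \<le> u q" "0 \<le> u q" using bspec[OF r, of q] Phi0_nonneg assms by auto
      then have "c * \<delta> powr k0 \<le> c * u q powr k0"
        using c assms by (intro mult_left_mono powr_mono2) auto
      then show "c * \<delta> powr k0 \<le> nuc (u q)" using c(3)[of "u q"] \<open>0 \<le> u q\<close> by simp
    qed auto
    then show "c * \<delta> powr k0 * (t - s) \<le> moment0 f t - moment0 f s"
      using mom_diff_nuc[OF st] st by (simp add: mult.commute mult.left_commute)
  qed
qed

text \<open>\<open>u\<close> stays in the compact set \<open>{0..\<rho>}\<close>, on which
  \<open>nuc\<close> is bounded.\<close>

lemma moment0_increment_le:
  obtains N where "0 \<le> N" "\<And>s t. 0 \<le> s \<Longrightarrow> s \<le> t \<Longrightarrow> moment0 f t - moment0 f s \<le> N * (t - s)"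
proof -
  have "compact (nuc ` {0..\<rho>})"
    by (intro compact_continuous_image continuous_on_subset[OF nuc_cont]) auto
  then have "\<exists>N. \<forall>z\<in>{0..\<rho>}. \<bar>nuc z\<bar> \<le> N"
    using compact_imp_bounded[of "nuc ` {0..\<rho>}"] by (simp add: bounded_iff)
  then obtain N where N: "\<forall>z\<in>{0..\<rho>}. \<bar>nuc z\<bar> \<le> N" by blast
  show ?thesis
  proof (rule that[of N])
    show "0 \<le> N" using bspec[OF N, of 0] rho_nonneg by auto
    fix s t :: real assume st: "0 \<le> s" "s \<le> t"
    have "integral {s..t} (\<lambda>r. nuc (u r)) \<le> integral {s..t} (\<lambda>_. N)"
    proof (rule integral_le)
      show "(\<lambda>r. nuc (u r)) integrable_on {s..t}"
        using st by (intro integrable_continuous_real continuous_on_subset[OF nuc_u_continuous]) auto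
      fix q assume "q \<in> {s..t}"
      then have "u q \<in> {0..\<rho>}" using u_nonneg[of q] u_le[of q] st by auto
      then show "nuc (u q) \<le> N" using N by fastforce
    qed auto
    then show "moment0 f t - moment0 f s \<le> N * (t - s)"
      using mom_diff_nuc[OF st] st by (simp add: mult.commute mult.left_commute)
  qed
qed

text \<open>The intervals \<open>A n\<close> decrease to the empty set. Up to the factor 1/\<delta>,
  the integral bounds the time needed to cross (0, q) at speed at least \<delta> a(x).\<close>

lemma integral_inv_a_small:
  assumes "0 < \<epsilon>" "0 < \<eta>"
  obtains q where "0 < q" "q \<le> \<eta>" "q \<le> 1" "(LBINT x:{0<..<q}. 1 / a x) \<le> \<epsilon>"
proof -
  define A where "A n = {0<..<1 / (real n + 1)}" for n
  have "(\<lambda>n. LBINT x:A n. 1 / a x) \<longlonglongrightarrow> (LBINT x:(\<Inter>n. A n). 1 / a x)"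
  proof (rule set_integral_cont_down)
    show "decseq A"
    proof (rule decseq_SucI)
      fix n
      have "1 / (real (Suc n) + 1) \<le> 1 / (real n + 1)" by (simp add: field_simps)
      then show "A (Suc n) \<subseteq> A n" by (force simp: A_def)
    qed
  qed (use inv_a_int in \<open>auto simp: A_def\<close>)
  moreover have "(\<Inter>n. A n) = {}"
  proof -
    have "\<exists>n. x \<notin> A n" for x
    proof (cases "0 < x")
      case True
      then obtain n where "inverse (of_nat (Suc n)) < x" using reals_Archimedean by blast
      then show ?thesis by (intro exI[of _ n]) (auto simp: A_def field_simps)
    qed (simp add: A_def)
    then show ?thesis by blast
  qed
  ultimately have "(\<lambda>n. LBINT x:A n. 1 / a x) \<longlonglongrightarrow> 0" by (simp add: set_lebesgue_integral_def)
  then have "\<forall>\<^sub>F n in sequentially. (LBINT x:A n. 1 / a x) < \<epsilon>"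
    using assms by (simp add: order_tendstoD(2))
  moreover have "\<forall>\<^sub>F n in sequentially. 1 / (real n + 1) < \<eta>"
    using LIMSEQ_inverse_real_of_nat assms(2) by (intro order_tendstoD(2)) (auto simp: inverse_eq_divide add.commute)
  ultimately have "\<forall>\<^sub>F n in sequentially. (LBINT x:A n. 1 / a x) < \<epsilon> \<and> 1 / (real n + 1) < \<eta>"
    by eventually_elim simp
  then obtain n where "(LBINT x:A n. 1 / a x) < \<epsilon>" "1 / (real n + 1) < \<eta>"
    unfolding eventually_sequentially by blast
  then show ?thesis by (intro that[of "1 / (real n + 1)"]) (auto simp: A_def)
qed

text \<open>
  The test function with derivative \<open>(1 - cutoff q) / a\<close> turns drift into time, but \<open>1 / a\<close> may be
  unbounded at \<open>0\<close>; hence \<open>a\<close> is replaced by \<open>max a (1 / (n + 1))\<close> and \<open>n\<close> tends to infinity.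
\<close>

lemma transport_out_of_small_sizes:
  assumes q: "0 < q" "2 * q \<le> 1" and \<delta>: "0 \<le> \<delta>"
    and \<Phi>: "\<And>x. 0 < x \<Longrightarrow> x < 2 * q \<Longrightarrow> \<Phi> x \<le> v"
    and st: "0 \<le> s" "s \<le> t"
    and r: "\<forall>r\<in>{s..t}. v + \<delta> \<le> u r"
  shows "\<delta> * integral {s..t} (mom (\<lambda>x. 1 - cutoff q x)) \<le> (LBINT x:{0<..<2*q}. 1 / a x) * moment0 f t"
proof -
  \<comment> \<open>A continuous weight that is 1 on sizes up to \<open>q\<close> and 0 beyond
    \<open>2 * q\<close>: continuity makes \<open>g n\<close> an admissible derivative of a test
    function.\<close>
  define \<omega> where "\<omega> x = 1 - cutoff q x" for x
  define \<kappa> where "\<kappa> n = 1 / (real n + 1)" for n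
  define g where "g n x = \<omega> x / max (a x) (\<kappa> n)" for n x
  define A where "A = (LBINT x:{0<..<2*q}. 1 / a x)"
  have \<kappa>: "0 < \<kappa> n" for n by (simp add: \<kappa>_def)
  have a_cont: "continuous_on {0..} a" using a_weight by (simp add: linear_weight_def)
  have \<omega>_cont: "continuous_on S \<omega>" for S
    unfolding \<omega>_def by (intro continuous_intros continuous_on_cutoff q)
  have \<omega>01: "0 \<le> \<omega> x" "\<omega> x \<le> 1" for x
    using cutoff_nonneg[OF q(1), of x] cutoff_le_1[OF q(1), of x] by (simp_all add: \<omega>_def)
  have \<omega>0: "\<omega> x = 0" if "2 * q \<le> x" for x
    using cutoff_eq_1[OF that q(1)] by (simp add: \<omega>_def)
  have \<omega>_weight: "linear_weight \<omega>"
    unfolding \<omega>_def by (intro linear_weight_intros linear_weight_cutoff q)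
  have g_cont: "continuous_on {0..} (g n)" for n
    unfolding g_def using \<kappa>[of n] by (intro continuous_intros \<omega>_cont a_cont) (auto simp: max_def)
  have g_nonneg: "0 \<le> g n x" for n x
    using \<omega>01[of x] \<kappa>[of n] by (simp add: g_def le_max_iff_disj)
  have g_bound: "\<bar>g n x\<bar> \<le> 1 / \<kappa> n" for n x
  proof -
    have "g n x \<le> 1 / \<kappa> n"
      unfolding g_def using \<omega>01[of x] \<kappa>[of n] by (intro frac_le) auto
    then show ?thesis using g_nonneg[of n x] by simp
  qed
  have ag_bounds: "0 \<le> a x * g n x" "a x * g n x \<le> 1" if x: "0 < x" for n x
  proof -
    show "0 \<le> a x * g n x" using a_pos[OF x] g_nonneg[of n x] by simp
    have "a x * \<omega> x \<le> max (a x) (\<kappa> n) * 1"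
      using \<omega>01[of x] a_pos[OF x] by (intro mult_mono) auto
    then show "a x * g n x \<le> 1" using a_pos[OF x] by (simp add: g_def less_max_iff_disj)
  qed
  have ag_weight: "linear_weight (\<lambda>x. a x * g n x)" for n
    by (rule linear_weight_mult_bounded[OF a_weight g_cont g_bound])
  have M0: "0 \<le> moment0 f t"
    using st mom_nonneg[of t "\<lambda>_. 1"] by (simp add: moment0_eq linear_weight_const)
  have *: "\<delta> * integral {s..t} (mom (\<lambda>x. a x * g n x)) \<le> A * moment0 f t" for n
  proof -
    obtain \<phi> where \<phi>: "continuous_on {0..} \<phi>" "\<And>x. 0 < x \<Longrightarrow> (\<phi> has_real_derivative g n x) (at x)"
      "\<And>x. 0 \<le> x \<Longrightarrow> \<phi> x = (LBINT z:{0..x}. g n z)" and \<phi>0: "\<phi> 0 = 0"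
      using ex_antiderivative[OF g_cont[of n]] by blast
    have \<phi>_nonneg: "0 \<le> \<phi> x" if "0 \<le> x" for x
      unfolding \<phi>(3)[OF that] set_lebesgue_integral_def using g_nonneg
      by (intro Bochner_Integration.integral_nonneg) auto
    have \<phi>_le: "\<phi> x \<le> A" if "0 \<le> x" for x
      unfolding \<phi>(3)[OF that] A_def set_lebesgue_integral_def
    proof (rule integral_mono_AE)
      show "integrable lborel (\<lambda>z. indicator {0..x} z *\<^sub>R g n z)"
        unfolding set_integrable_def[symmetric]
        by (intro borel_integrable_atLeastAtMost' continuous_on_subset[OF g_cont]) auto
      show "integrable lborel (\<lambda>z. indicator {0<..<2 * q} z *\<^sub>R (1 / a z))"
        unfolding set_integrable_def[symmetric]
        by (rule set_integrable_subset[OF inv_a_int]) (use q in auto)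
      \<comment> \<open>The point 0 lies in \<open>{0..x}\<close> but not in the open interval, so
        the comparison holds only outside a null set.\<close>
      have "indicator {0..x} z *\<^sub>R g n z \<le> indicator {0<..<2 * q} z *\<^sub>R (1 / a z)" if "z \<noteq> 0" for z
      proof (cases "0 < z \<and> z < 2 * q")
        case True
        then have "g n z \<le> 1 / a z"
          unfolding g_def using \<omega>01[of z] a_pos[of z] by (intro frac_le) auto
        moreover have "0 \<le> 1 / a z" using a_pos[of z] True by simp
        ultimately show ?thesis using True by (auto simp: indicator_def)
      next
        case False
        then have "z < 0 \<or> 2 * q \<le> z" using that by linarith
        then show ?thesis using \<omega>0[of z] q by (auto simp: indicator_def g_def)
      qed
      then show "AE z in lborel. indicator {0..x} z *\<^sub>R g n z \<le> indicator {0<..<2 * q} z *\<^sub>R (1 / a z)"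
        using AE_lborel_singleton[of "0::real"] by (auto elim!: eventually_mono)
    qed
    have \<phi>_weight: "linear_weight \<phi>"
      by (rule linear_weight_bounded[OF \<phi>(1), of A]) (use \<phi>_nonneg \<phi>_le in auto)
    have "\<delta> * integral {s..t} (mom (\<lambda>x. a x * g n x)) = integral {s..t} (\<lambda>r. \<delta> * mom (\<lambda>x. a x * g n x) r)"
      by simp
    also have "\<dots> \<le> integral {s..t} (flux (\<phi> 0) (g n))"
    proof (rule integral_le)
      show "(\<lambda>r. \<delta> * mom (\<lambda>x. a x * g n x) r) integrable_on {s..t}"
        using st by (intro integrable_continuous_real continuous_intros
            continuous_on_subset[OF mom_continuous[OF ag_weight]]) auto
      show "flux (\<phi> 0) (g n) integrable_on {s..t}"
        using st by (intro integrable_continuous_real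
            continuous_on_subset[OF flux_continuous[OF g_cont g_bound]]) auto
      fix p assume p: "p \<in> {s..t}"
      \<comment> \<open>Below \<open>2 * q\<close> the excess of \<open>u p\<close> over
        \<open>\<Phi> x\<close> is at least \<open>\<delta>\<close>; beyond, \<open>g n\<close>
        vanishes.\<close>
      have "mom (\<lambda>x. \<delta> * (a x * g n x)) p \<le> mom (\<lambda>x. (a x * u p - b x) * g n x) p"
      proof (rule mom_mono)
        fix x :: real assume x: "0 < x"
        show "\<delta> * (a x * g n x) \<le> (a x * u p - b x) * g n x"
        proof (cases "x < 2 * q")
          case True
          then have "\<delta> \<le> u p - \<Phi> x" using \<Phi>[OF x] bspec[OF r p] by simp
          then have "\<delta> * (a x * g n x) \<le> (u p - \<Phi> x) * (a x * g n x)"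
            using a_pos[OF x] g_nonneg[of n x] by (intro mult_right_mono) auto
          then show ?thesis by (simp add: drift_eq[OF x] mult_ac)
        next
          case False
          then show ?thesis using \<omega>0[of x] by (simp add: g_def)
        qed
      qed (use p st in \<open>auto intro!: flux_weight[OF g_cont g_bound] linear_weight_intros ag_weight\<close>)
      then show "\<delta> * mom (\<lambda>x. a x * g n x) p \<le> flux (\<phi> 0) (g n) p"
        by (simp add: flux_def \<phi>0 mom_cmult)
    qed
    also have "\<dots> = mom \<phi> t - mom \<phi> s"
      by (rule transport[OF \<phi>(1,2) g_cont g_bound st, symmetric])
    also have "\<dots> \<le> mom \<phi> t"
      using st \<phi>_nonneg by (simp add: mom_nonneg \<phi>_weight)
    also have "\<dots> \<le> mom (\<lambda>x. A * 1) t"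
      using st \<phi>_le by (intro mom_mono \<phi>_weight linear_weight_const) auto
    also have "\<dots> = A * moment0 f t" unfolding mom_cmult moment0_eq ..
    finally show ?thesis .
  qed
  \<comment> \<open>For fixed \<open>x > 0\<close>, \<open>a x * g n x\<close> equals
    \<open>\<omega> x\<close> as soon as \<open>\<kappa> n < a x\<close>. It always lies between 0
    and 1, so \<open>f p\<close> dominates here and the zeroth moment dominates in the time integral
    below.\<close>
  have lim_mom: "(\<lambda>n. mom (\<lambda>x. a x * g n x) p) \<longlonglongrightarrow> mom \<omega> p" if p: "0 \<le> p" for p
    unfolding mom_def set_lebesgue_integral_def
  proof (rule integral_dominated_convergence)
    show "integrable lborel (\<lambda>x. norm (indicator {0<..} x *\<^sub>R (1 * f p x)))"
      using mom_integrable[OF p linear_weight_const[of 1]] unfolding set_integrable_def by (rule integrable_norm)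
    show "(\<lambda>x. indicator {0<..} x *\<^sub>R (\<omega> x * f p x)) \<in> borel_measurable lborel"
      using mom_integrable[OF p \<omega>_weight] unfolding set_integrable_def by (rule borel_measurable_integrable)
    show "(\<lambda>x. indicator {0<..} x *\<^sub>R (a x * g n x * f p x)) \<in> borel_measurable lborel" for n
      using mom_integrable[OF p ag_weight] unfolding set_integrable_def by (rule borel_measurable_integrable)
    show "AE x in lborel. (\<lambda>n. indicator {0<..} x *\<^sub>R (a x * g n x * f p x))
        \<longlonglongrightarrow> indicator {0<..} x *\<^sub>R (\<omega> x * f p x)"
    proof (rule AE_I2)
      fix x :: real
      show "(\<lambda>n. indicator {0<..} x *\<^sub>R (a x * g n x * f p x)) \<longlonglongrightarrow> indicator {0<..} x *\<^sub>R (\<omega> x * f p x)"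
      proof (cases "0 < x")
        case True
        have "\<forall>\<^sub>F n in sequentially. \<kappa> n < a x"
          unfolding \<kappa>_def using LIMSEQ_inverse_real_of_nat a_pos[OF True]
          by (intro order_tendstoD(2)) (auto simp: inverse_eq_divide add.commute)
        then have "\<forall>\<^sub>F n in sequentially. indicator {0<..} x *\<^sub>R (a x * g n x * f p x) = indicator {0<..} x *\<^sub>R (\<omega> x * f p x)"
          by eventually_elim (use a_pos[OF True] in \<open>simp add: g_def max_def\<close>)
        then show ?thesis by (rule tendsto_eventually)
      qed simp
    qed
    show "AE x in lborel. norm (indicator {0<..} x *\<^sub>R (a x * g n x * f p x)) \<le> norm (indicator {0<..} x *\<^sub>R (1 * f p x))" for n
    proof (rule AE_I2)
      fix x :: real
      have "\<bar>a x * g n x\<bar> \<le> 1" if "0 < x" using ag_bounds[OF that, of n] by simp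
      then show "norm (indicator {0<..} x *\<^sub>R (a x * g n x * f p x)) \<le> norm (indicator {0<..} x *\<^sub>R (1 * f p x))"
        using mult_right_mono[of "\<bar>a x * g n x\<bar>" 1 "\<bar>f p x\<bar>"] by (auto simp: indicator_def abs_mult)
    qed
  qed
  have "(\<lambda>n. integral {s..t} (mom (\<lambda>x. a x * g n x))) \<longlonglongrightarrow> integral {s..t} (mom \<omega>)"
  proof (rule dominated_convergence(2)[where h = "mom (\<lambda>_. 1)"])
    show "mom (\<lambda>x. a x * g n x) integrable_on {s..t}" for n
      using st by (intro integrable_continuous_real continuous_on_subset[OF mom_continuous[OF ag_weight]]) auto
    show "mom (\<lambda>_. 1) integrable_on {s..t}"
      using st by (intro integrable_continuous_real
          continuous_on_subset[OF mom_continuous[OF linear_weight_const]]) auto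
    show "norm (mom (\<lambda>x. a x * g n x) p) \<le> mom (\<lambda>_. 1) p" if "p \<in> {s..t}" for n p
    proof -
      have p: "0 \<le> p" using that st by simp
      have "0 \<le> mom (\<lambda>x. a x * g n x) p" by (intro mom_nonneg p ag_weight ag_bounds)
      moreover have "mom (\<lambda>x. a x * g n x) p \<le> mom (\<lambda>_. 1) p"
        by (intro mom_mono p ag_weight linear_weight_const ag_bounds)
      ultimately show ?thesis by simp
    qed
    show "\<And>p. p \<in> {s..t} \<Longrightarrow> (\<lambda>n. mom (\<lambda>x. a x * g n x) p) \<longlonglongrightarrow> mom \<omega> p"
      using lim_mom st by auto
  qed
  then have "(\<lambda>n. \<delta> * integral {s..t} (mom (\<lambda>x. a x * g n x))) \<longlonglongrightarrow> \<delta> * integral {s..t} (mom \<omega>)"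
    by (rule tendsto_mult_left)
  then have "\<delta> * integral {s..t} (mom \<omega>) \<le> A * moment0 f t"
    by (rule LIMSEQ_le_const2) (use * in blast)
  then show ?thesis by (simp add: A_def \<omega>_def[abs_def])
qed

text \<open>With K = \<rho>/q bounding the particles counted by \<open>cutoff q\<close>, a window
  from s to t of length \<tau> yields \<delta> \<tau> (M_0(s) - K) \<le> (\<delta> \<tau> / 2)
  (M_0(s) + N \<tau>), hence M_0(s) \<le> 2 K + N \<tau>. The right-hand side does not depend on s,
  while M_0 would be unbounded.\<close>

lemma u_tendsto: "(u \<longlongrightarrow> \<Phi>0) at_top"
proof (rule order_tendstoI)
  fix y assume "y < \<Phi>0"
  then show "\<forall>\<^sub>F t in at_top. y < u t"
    using u_gt unfolding eventually_at_top_linorder by (intro exI[of _ 0]) force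
next
  fix y assume y: "\<Phi>0 < y"
  show "\<forall>\<^sub>F t in at_top. u t < y"
  proof (rule ccontr)
    assume "\<not> ?thesis"
    then have large: "\<exists>t\<ge>T. y \<le> u t" for T
      unfolding eventually_at_top_linorder by (metis not_le)
    \<comment> \<open>A quarter of the gap leaves room for three levels:
      \<open>\<Phi>0 + 4 * \<delta> = y\<close> opens a window, \<open>u\<close> stays above
      \<open>\<Phi>0 + 2 * \<delta>\<close> on it, and \<open>\<Phi>\<close> stays below
      \<open>\<Phi>0 + \<delta>\<close> on small sizes. The remaining excess is
      \<open>\<delta>\<close>.\<close>
    define \<delta> where "\<delta> = (y - \<Phi>0) / 4"
    have \<delta>: "0 < \<delta>" "\<Phi>0 + 2 * (2 * \<delta>) = y" using y by (simp_all add: \<delta>_def field_simps)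
    have \<delta>2: "0 < 2 * \<delta>" using \<delta> by simp
    obtain \<tau> where \<tau>: "0 < \<tau>" "\<And>t r. \<tau> \<le> t \<Longrightarrow> \<Phi>0 + 2 * (2 * \<delta>) \<le> u t \<Longrightarrow>
        t - \<tau> \<le> r \<Longrightarrow> r \<le> t \<Longrightarrow> \<Phi>0 + 2 * \<delta> \<le> u r"
      using u_window[OF \<delta>2] by blast
    have window: "\<forall>r\<in>{t - \<tau>..t}. \<Phi>0 + 2 * \<delta> \<le> u r" if "\<tau> \<le> t" "y \<le> u t" for t
      using \<tau>(2)[of t] that \<delta>(2) by simp
    obtain m where m: "0 < m" "\<And>s t. 0 \<le> s \<Longrightarrow> s \<le> t \<Longrightarrow> (\<forall>r\<in>{s..t}. \<Phi>0 + 2 * \<delta> \<le> u r)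
        \<Longrightarrow> m * (t - s) \<le> moment0 f t - moment0 f s"
      using moment0_increment_ge[OF \<delta>2] by blast
    obtain N where N: "0 \<le> N" "\<And>s t. 0 \<le> s \<Longrightarrow> s \<le> t \<Longrightarrow> moment0 f t - moment0 f s \<le> N * (t - s)"
      using moment0_increment_le by blast
    \<comment> \<open>Each induction step waits for a later time with \<open>y \<le> u t\<close>;
      the window preceding it adds at least \<open>m * \<tau>\<close> particles.\<close>
    have "\<exists>T\<ge>0. real n * (m * \<tau>) \<le> moment0 f T" for n
    proof (induction n)
      case 0
      have "0 \<le> moment0 f 0"
        using mom_nonneg[of 0 "\<lambda>_. 1"] by (simp add: moment0_eq linear_weight_const)
      then show ?case by (intro exI[of _ 0]) simp
    next
      case (Suc n)
      then obtain T where T: "0 \<le> T" "real n * (m * \<tau>) \<le> moment0 f T" by blast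
      obtain t where t: "T + \<tau> \<le> t" "y \<le> u t" using large by blast
      have "m * (t - (t - \<tau>)) \<le> moment0 f t - moment0 f (t - \<tau>)"
        using t T \<tau>(1) by (intro m(2) window) auto
      moreover have "moment0 f T \<le> moment0 f (t - \<tau>)" using t T by (intro moment0_mono) auto
      ultimately have "real (Suc n) * (m * \<tau>) \<le> moment0 f t" using T(2) by (simp add: algebra_simps)
      then show ?case using t T \<tau>(1) by (intro exI[of _ t]) auto
    qed
    note steps = this
    have unbounded: "\<exists>T\<ge>0. B \<le> moment0 f T" for B
    proof -
      have "0 < m * \<tau>" using m \<tau> by simp
      then obtain n where "B < real n * (m * \<tau>)" using reals_Archimedean3 by blast
      then show ?thesis using steps[of n] by force
    qed
    obtain \<eta> where \<eta>: "0 < \<eta>" "\<And>x. 0 < x \<Longrightarrow> x < \<eta> \<Longrightarrow> \<Phi> x \<le> \<Phi>0 + \<delta>"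
      using Phi_near_0[OF \<delta>(1)] by blast
    have "0 < \<delta> * \<tau> / 2" using \<delta> \<tau> by simp
    \<comment> \<open>The factor 1/2 lets the number of particles on the right be absorbed by the
      left-hand side of the final inequality.\<close>
    then obtain q' where q': "0 < q'" "q' \<le> \<eta>" "q' \<le> 1" "(LBINT x:{0<..<q'}. 1 / a x) \<le> \<delta> * \<tau> / 2"
      using integral_inv_a_small \<eta>(1) by blast
    define q where "q = q' / 2"
    have q: "0 < q" "2 * q \<le> 1" "2 * q \<le> \<eta>" "(LBINT x:{0<..<2 * q}. 1 / a x) \<le> \<delta> * \<tau> / 2"
      using q' by (auto simp: q_def)
    define K where "K = \<rho> / q"
    obtain T where T: "0 \<le> T" "2 * K + N * \<tau> + 1 \<le> moment0 f T" using unbounded by blast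
    obtain t where t: "T + \<tau> \<le> t" "y \<le> u t" using large by blast
    define s where "s = t - \<tau>"
    have st: "0 \<le> s" "s \<le> t" "T \<le> s" "t - s = \<tau>" using t T \<tau>(1) by (auto simp: s_def)
    have w: "linear_weight (\<lambda>x. 1 - cutoff q x)"
      by (intro linear_weight_intros linear_weight_cutoff q)
    have "\<delta> * ((moment0 f s - K) * \<tau>) \<le> \<delta> * integral {s..t} (mom (\<lambda>x. 1 - cutoff q x))"
    proof (rule mult_left_mono)
      have "integral {s..t} (\<lambda>_. moment0 f s - K) \<le> integral {s..t} (mom (\<lambda>x. 1 - cutoff q x))"
      proof (rule integral_le)
        show "mom (\<lambda>x. 1 - cutoff q x) integrable_on {s..t}"
          using st by (intro integrable_continuous_real continuous_on_subset[OF mom_continuous[OF w]]) auto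
        fix p assume p: "p \<in> {s..t}"
        then have p0: "0 \<le> p" using st by simp
        \<comment> \<open>The ramp lies below the line \<open>x / q\<close>, so the first moment
          bounds how many particles have left the small sizes.\<close>
        have "mom (\<lambda>x. 1 - 1 / q * x) p \<le> mom (\<lambda>x. 1 - cutoff q x) p"
          using cutoff_le[OF q(1)] by (intro mom_mono p0 w linear_weight_intros) simp
        also have "mom (\<lambda>x. 1 - 1 / q * x) p = moment0 f p - 1 / q * mom (\<lambda>x. x) p"
          using p0 by (simp only: mom_diff linear_weight_intros mom_cmult moment0_eq)
        finally have "moment0 f p - 1 / q * mom (\<lambda>x. x) p \<le> mom (\<lambda>x. 1 - cutoff q x) p" .
        moreover have "1 / q * mom (\<lambda>x. x) p \<le> 1 / q * \<rho>"
          using mom_id_le[OF p0] q(1) by (intro mult_left_mono) auto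
        moreover have "moment0 f s \<le> moment0 f p" using p st by (intro moment0_mono) auto
        ultimately show "moment0 f s - K \<le> mom (\<lambda>x. 1 - cutoff q x) p" by (simp add: K_def)
      qed auto
      then show "(moment0 f s - K) * \<tau> \<le> integral {s..t} (mom (\<lambda>x. 1 - cutoff q x))"
        using st by (simp add: mult.commute)
    qed (use \<delta> in simp)
    also have "\<dots> \<le> (LBINT x:{0<..<2*q}. 1 / a x) * moment0 f t"
    proof (rule transport_out_of_small_sizes[where v = "\<Phi>0 + \<delta>"])
      show "\<And>x. 0 < x \<Longrightarrow> x < 2 * q \<Longrightarrow> \<Phi> x \<le> \<Phi>0 + \<delta>" using \<eta>(2) q(3) by simp
      have "\<tau> \<le> t" using st by simp
      from window[OF this t(2)] show "\<forall>r\<in>{s..t}. \<Phi>0 + \<delta> + \<delta> \<le> u r"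
        by (simp add: s_def add.commute)
    qed (use q st \<delta> in auto)
    also have "\<dots> \<le> (\<delta> * \<tau> / 2) * (moment0 f s + N * \<tau>)"
    proof (rule mult_mono[OF q(4)])
      show "moment0 f t \<le> moment0 f s + N * \<tau>" using N(2)[OF st(1,2)] st(4) by simp
      show "0 \<le> moment0 f t"
        using mom_nonneg[of t "\<lambda>_. 1"] st by (simp add: moment0_eq linear_weight_const)
    qed (use \<delta> \<tau> in auto)
    finally have "(\<delta> * \<tau>) * (2 * (moment0 f s - K)) \<le> (\<delta> * \<tau>) * (moment0 f s + N * \<tau>)"
      by (simp add: algebra_simps)
    moreover have "0 < \<delta> * \<tau>" using \<delta> \<tau> by simp
    ultimately have "2 * (moment0 f s - K) \<le> moment0 f s + N * \<tau>"
      by (rule mult_left_le_imp_le)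
    then have "moment0 f s \<le> 2 * K + N * \<tau>" by (simp add: right_diff_distrib)
    moreover have "moment0 f T \<le> moment0 f s" using T st by (intro moment0_mono) auto
    ultimately show False using T(2) by simp
  qed
qed

end

section \<open>Concentration of mass at size zero\<close>

lemma scale_measure_eq_density: "scale_measure c M = density M (\<lambda>_. c)"
  by (rule measure_eqI) (simp_all add: emeasure_density_const)

lemma integral_scale_measure:
  fixes \<psi> :: "'a \<Rightarrow> real"
  assumes "0 \<le> c" "\<psi> \<in> borel_measurable M"
  shows "(\<integral>x. \<psi> x \<partial>scale_measure (ennreal c) M) = c * (\<integral>x. \<psi> x \<partial>M)"
  unfolding scale_measure_eq_density using assms by (subst integral_density) auto

section \<open>Decay of the mass in large sizes\<close>

context nucleation_solution
begin

lemma Phi_less: "0 \<le> x \<Longrightarrow> x < y \<Longrightarrow> \<Phi> x < \<Phi> y"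
  using Phi_mono by (auto simp: strict_mono_on_def)

lemma Phi_0: "\<Phi> 0 = \<Phi>0"
  by (simp add: Phi_def)

text \<open>Compactness covers the sizes up to \<open>max p 2\<close>; all larger ones exceed 1 and
  fall under the infimum in (iii).\<close>

lemma a_bounded_below:
  assumes "0 < p"
  obtains c where "0 < c" "\<And>x. p \<le> x \<Longrightarrow> c \<le> a x"
proof -
  have "continuous_on {p..max p 2} a"
    using a_weight assms by (auto simp: linear_weight_def elim!: continuous_on_subset)
  then obtain z where z: "z \<in> {p..max p 2}" "\<And>x. x \<in> {p..max p 2} \<Longrightarrow> a z \<le> a x"
    using continuous_attains_inf[of "{p..max p 2}" a] by force
  have b: "bdd_below (a ` {1<..})"
    using a_pos by (intro bdd_belowI2[of _ 0]) (auto intro!: less_imp_le)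
  show ?thesis
  proof (rule that[of "min (a z) (INF x\<in>{1<..}. a x)"])
    show "0 < min (a z) (INF x\<in>{1<..}. a x)" using a_inf a_pos[of z] z(1) assms by auto
    fix x assume "p \<le> x"
    show "min (a z) (INF x\<in>{1<..}. a x) \<le> a x"
    proof (cases "x \<le> max p 2")
      case True
      then show ?thesis using z(2)[of x] \<open>p \<le> x\<close> by (simp add: min_le_iff_disj)
    next
      case False
      then have "(INF x\<in>{1<..}. a x) \<le> a x" by (intro cINF_lower b) auto
      then show ?thesis by (simp add: min_le_iff_disj)
    qed
  qed
qed

text \<open>\<open>T\<close> and \<open>\<kappa>\<close> are uniform in \<open>R\<close>: the cutoff
  vanishes up to \<open>p\<close>, and for \<open>x > p\<close> the drift is at most
  \<open>- (c * e)\<close>. A single \<open>T\<close> thus serves both for tightness, with large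
  \<open>R\<close>, and for decay. The coefficient 0 of the nucleation term is the value of
  \<open>tail R\<close> at 0.\<close>

lemma flux_cutoff_le:
  assumes "0 < p"
  obtains T \<kappa> where "0 \<le> T" "0 < \<kappa>" "\<And>R r. p \<le> R \<Longrightarrow> T \<le> r \<Longrightarrow> flux 0 (cutoff R) r \<le> - \<kappa> * mom (cutoff R) r"
proof -
  obtain c where c: "0 < c" "\<And>x. p \<le> x \<Longrightarrow> c \<le> a x" using a_bounded_below[OF assms] by blast
  \<comment> \<open>Once \<open>u\<close> is below the midpoint of \<open>\<Phi>0\<close> and
    \<open>\<Phi> p\<close>, every \<open>x > p\<close> keeps the margin \<open>e\<close> between
    \<open>\<Phi> x\<close> and \<open>u\<close>.\<close>
  define e where "e = (\<Phi> p - \<Phi>0) / 2"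
  have e: "0 < e" "\<Phi>0 + e = \<Phi> p - e"
    using Phi_less[of 0 p] Phi_0 assms by (simp_all add: e_def field_simps)
  have "\<forall>\<^sub>F t in at_top. u t < \<Phi>0 + e" by (rule order_tendstoD(2)[OF u_tendsto]) (use e(1) in simp)
  then obtain T where T: "\<And>t. T \<le> t \<Longrightarrow> u t < \<Phi>0 + e" unfolding eventually_at_top_linorder by blast
  show ?thesis
  proof (rule that[of "max 0 T" "c * e"])
    show "0 < c * e" using c e by simp
    fix R r assume R: "p \<le> R" and r: "max 0 T \<le> r"
    have R0: "0 < R" using R assms by simp
    have "mom (\<lambda>x. (a x * u r - b x) * cutoff R x) r \<le> mom (\<lambda>x. (- (c * e)) * cutoff R x) r"
    proof (rule mom_mono)
      fix x :: real assume x: "0 < x"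
      show "(a x * u r - b x) * cutoff R x \<le> - (c * e) * cutoff R x"
      proof (cases "x \<le> p")
        case True
        then show ?thesis using R R0 by (simp add: cutoff_eq_0)
      next
        case False
        then have "e \<le> \<Phi> x - u r" using Phi_less[of p x] T[of r] r e assms by simp
        then have "c * e \<le> a x * (\<Phi> x - u r)" using c(2)[of x] False e(1) a_pos[OF x] by (intro mult_mono) auto
        then have "a x * u r - b x \<le> - (c * e)" by (simp add: b_eq[OF x] right_diff_distrib)
        then show ?thesis using cutoff_nonneg[OF R0] by (rule mult_right_mono)
      qed
    next
      show "linear_weight (\<lambda>x. (a x * u r - b x) * cutoff R x)"
        by (rule flux_weight[of _ 1])
           (simp_all add: continuous_on_cutoff R0 cutoff_nonneg cutoff_le_1)
      show "linear_weight (\<lambda>x. - (c * e) * cutoff R x)"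
        by (intro linear_weight_intros linear_weight_cutoff R0)
    qed (use r in simp)
    then show "flux 0 (cutoff R) r \<le> - (c * e) * mom (cutoff R) r"
      unfolding mom_cmult by (simp add: flux_def)
  qed simp
qed

lemma mom_tail_diff_le:
  assumes "0 < R" "0 \<le> s" "s \<le> t" and "\<And>r. s \<le> r \<Longrightarrow> r \<le> t \<Longrightarrow> flux 0 (cutoff R) r \<le> c"
  shows "mom (tail R) t - mom (tail R) s \<le> c * (t - s)"
proof (rule transport_le[where g = "cutoff R" and B = 1])
  show "\<And>r. s \<le> r \<Longrightarrow> r \<le> t \<Longrightarrow> flux (tail R 0) (cutoff R) r \<le> c"
    using assms by (simp add: tail_eq_0)
qed (use assms in \<open>simp_all add: continuous_on_tail continuous_on_cutoff has_real_derivative_tail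
      cutoff_nonneg cutoff_le_1\<close>)

text \<open>Dominated convergence with majorant \<open>x * f T x\<close>: at fixed \<open>x\<close>
  the tail vanishes for large \<open>n\<close>.\<close>

lemma mom_tail_tendsto_0_size:
  assumes "0 \<le> T"
  shows "(\<lambda>n. mom (tail (real (Suc n))) T) \<longlonglongrightarrow> 0"
proof -
  have "(\<lambda>n. mom (tail (real (Suc n))) T) \<longlonglongrightarrow> (\<integral>x. 0 \<partial>(lborel :: real measure))"
    unfolding mom_def set_lebesgue_integral_def
  proof (rule integral_dominated_convergence)
    show "integrable lborel (\<lambda>x. norm (indicator {0<..} x *\<^sub>R (x * f T x)))"
      using mom_integrable[OF assms linear_weight_id] unfolding set_integrable_def by (rule integrable_norm)
    show "(\<lambda>x. indicator {0<..} x *\<^sub>R (tail (real (Suc n)) x * f T x)) \<in> borel_measurable lborel" for n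
      using mom_integrable[OF assms linear_weight_tail, of "real (Suc n)"]
      unfolding set_integrable_def by (intro borel_measurable_integrable) simp
    show "AE x in lborel. (\<lambda>n. indicator {0<..} x *\<^sub>R (tail (real (Suc n)) x * f T x)) \<longlonglongrightarrow> 0"
    proof (rule AE_I2)
      fix x :: real
      have "\<forall>\<^sub>F n in sequentially. x \<le> real (Suc n)"
      proof -
        obtain N where "x \<le> real N" using real_arch_simple by blast
        then show ?thesis unfolding eventually_sequentially by (intro exI[of _ N]) auto
      qed
      then have "\<forall>\<^sub>F n in sequentially. indicator {0<..} x *\<^sub>R (tail (real (Suc n)) x * f T x) = 0"
        by eventually_elim (simp add: tail_eq_0)
      then show "(\<lambda>n. indicator {0<..} x *\<^sub>R (tail (real (Suc n)) x * f T x)) \<longlonglongrightarrow> 0"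
        by (rule tendsto_eventually)
    qed
    show "AE x in lborel. norm (indicator {0<..} x *\<^sub>R (tail (real (Suc n)) x * f T x))
        \<le> norm (indicator {0<..} x *\<^sub>R (x * f T x))" for n
    proof (rule AE_I2)
      fix x :: real
      have "\<bar>tail (real (Suc n)) x\<bar> \<le> \<bar>x\<bar>" if "0 < x"
        using tail_nonneg[of "real (Suc n)" x] tail_le[of "real (Suc n)" x] that by simp
      then show "norm (indicator {0<..} x *\<^sub>R (tail (real (Suc n)) x * f T x))
        \<le> norm (indicator {0<..} x *\<^sub>R (x * f T x))"
        by (auto simp: indicator_def abs_mult intro!: mult_right_mono)
    qed
  qed simp
  then show ?thesis by simp
qed

text \<open>After \<open>T\<close> this moment is nonincreasing, so smallness at a single time
  \<open>t1\<close> is enough. At \<open>t1\<close> the sizes up to \<open>4 * R\<close> are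
  controlled by the moment of \<open>cutoff p0\<close>, which must become small at some time, and
  the larger ones by \<open>tail R\<close>, whose moment was small at \<open>T\<close> and has not
  grown.\<close>

lemma mom_tail_tendsto_0:
  assumes "0 < p"
  shows "(mom (tail p) \<longlongrightarrow> 0) at_top"
proof -
  \<comment> \<open>Halving makes \<open>cutoff p0\<close> equal to 1 on all sizes beyond
    \<open>p\<close>.\<close>
  define p0 where "p0 = p / 2"
  have p0: "0 < p0" "p = 2 * p0" using assms by (auto simp: p0_def)
  obtain T \<kappa> where T: "0 \<le> T" and \<kappa>: "0 < \<kappa>"
    and fl: "\<And>R r. p0 \<le> R \<Longrightarrow> T \<le> r \<Longrightarrow> flux 0 (cutoff R) r \<le> - \<kappa> * mom (cutoff R) r"
    using flux_cutoff_le[OF p0(1)] by blast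
  have cutoff_mom_nonneg: "0 \<le> mom (cutoff R) r" if "p0 \<le> R" "T \<le> r" for R r
    using that T p0 by (intro mom_nonneg linear_weight_cutoff cutoff_nonneg) auto
  have tail_mom_nonneg: "0 \<le> mom (tail R) r" if "p0 \<le> R" "T \<le> r" for R r
    using that T p0 by (intro mom_nonneg linear_weight_tail tail_nonneg) auto
  have anti: "mom (tail R) t \<le> mom (tail R) s" if "p0 \<le> R" "T \<le> s" "s \<le> t" for R s t
  proof -
    have "mom (tail R) t - mom (tail R) s \<le> 0 * (t - s)"
    proof (rule mom_tail_diff_le)
      fix r assume r: "s \<le> r" "r \<le> t"
      have "0 \<le> \<kappa> * mom (cutoff R) r" using cutoff_mom_nonneg[of R r] \<kappa> that r by simp
      then show "flux 0 (cutoff R) r \<le> 0" using fl[of R r] that r by simp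
    qed (use that T p0 in auto)
    then show ?thesis by simp
  qed
  have small_cutoff: "\<exists>t\<ge>T. mom (cutoff p0) t \<le> \<epsilon>" if \<epsilon>: "0 < \<epsilon>" for \<epsilon>
  proof (rule ccontr)
    assume "\<not> ?thesis"
    then have big: "\<And>t. T \<le> t \<Longrightarrow> \<epsilon> < mom (cutoff p0) t" by force
    \<comment> \<open>By this time a decrease at rate \<open>\<kappa> * \<epsilon>\<close> would
      exceed the initial value by 1 and make a nonnegative moment negative.\<close>
    define t where "t = T + (mom (tail p0) T + 1) / (\<kappa> * \<epsilon>)"
    have m: "0 \<le> mom (tail p0) T" by (rule tail_mom_nonneg) auto
    have t: "T \<le> t" using m \<kappa> \<epsilon> by (simp add: t_def)
    have "mom (tail p0) t - mom (tail p0) T \<le> - (\<kappa> * \<epsilon>) * (t - T)"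
    proof (rule mom_tail_diff_le)
      fix r assume "T \<le> r" "r \<le> t"
      then have "\<kappa> * \<epsilon> \<le> \<kappa> * mom (cutoff p0) r" using big[of r] \<kappa> by (intro mult_left_mono) auto
      then show "flux 0 (cutoff p0) r \<le> - (\<kappa> * \<epsilon>)" using fl[of p0 r] \<open>T \<le> r\<close> by simp
    qed (use p0 T t in auto)
    also have "\<dots> = - (mom (tail p0) T + 1)" using \<kappa> \<epsilon> by (simp add: t_def)
    finally show False using tail_mom_nonneg[of p0 t] t by simp
  qed
  show ?thesis
  proof (rule tendstoI)
    fix e :: real assume e: "0 < e"
    have "\<forall>\<^sub>F n in sequentially. mom (tail (real (Suc n))) T < e / 8"
      using order_tendstoD(2)[OF mom_tail_tendsto_0_size[OF T], of "e / 8"] e by simp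
    moreover have "\<forall>\<^sub>F n in sequentially. p0 \<le> real (Suc n)"
    proof -
      obtain N where "p0 \<le> real N" using real_arch_simple by blast
      then show ?thesis unfolding eventually_sequentially by (intro exI[of _ N]) auto
    qed
    ultimately have "\<forall>\<^sub>F n in sequentially. mom (tail (real (Suc n))) T < e / 8 \<and> p0 \<le> real (Suc n)"
      by eventually_elim simp
    then obtain R where R: "0 < R" "p0 \<le> R" "mom (tail R) T < e / 8"
      unfolding eventually_sequentially by (metis le_refl of_nat_0_less_iff zero_less_Suc)
    \<comment> \<open>With the factors \<open>4 * R\<close> and 2 below, the two contributions are
      at most \<open>e / 4\<close> each.\<close>
    have "0 < e / (16 * R)" using e R by simp
    then obtain t1 where t1: "T \<le> t1" "mom (cutoff p0) t1 \<le> e / (16 * R)" using small_cutoff by blast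
    have pt: "tail p x \<le> 4 * R * cutoff p0 x + 2 * tail R x" if x: "0 < x" for x
    proof (cases "x \<le> p")
      case True
      then show ?thesis
        using R cutoff_nonneg[OF p0(1), of x] tail_nonneg[OF R(1), of x] by (simp add: tail_eq_0 assms)
    next
      case False
      then have c: "cutoff p0 x = 1" using p0 by (simp add: cutoff_eq_1)
      have "tail p x \<le> x" using tail_le[OF assms] x by simp
      moreover have "x \<le> 4 * R + 2 * tail R x"
        using tail_nonneg[OF R(1), of x] tail_eq[of R x] R(1) by (cases "x \<le> 4 * R") auto
      ultimately show ?thesis using c by simp
    qed
    have t10: "0 \<le> t1" using t1 T by simp
    have "mom (tail p) t1 \<le> mom (\<lambda>x. 4 * R * cutoff p0 x + 2 * tail R x) t1"
      using t10 pt assms R p0 by (intro mom_mono linear_weight_intros linear_weight_cutoff linear_weight_tail) auto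
    also have "\<dots> = 4 * R * mom (cutoff p0) t1 + 2 * mom (tail R) t1"
      using t10 R p0 by (simp add: mom_add mom_cmult linear_weight_intros linear_weight_cutoff linear_weight_tail)
    also have "\<dots> \<le> 4 * R * (e / (16 * R)) + 2 * (e / 8)"
      using R t1 anti[of R T t1] by (intro add_mono mult_left_mono) auto
    also have "\<dots> < e" using R e by simp
    finally have lt: "mom (tail p) t1 < e" .
    have "dist (mom (tail p) t) 0 < e" if "t1 \<le> t" for t
      using anti[of p t1 t] tail_mom_nonneg[of p t] lt that t1 p0 by (simp add: dist_real_def)
    then show "\<forall>\<^sub>F t in at_top. dist (mom (tail p) t) 0 < e"
      unfolding eventually_at_top_linorder by blast
  qed
qed

text \<open>Beyond \<open>4 * p\<close>, twice the tail is \<open>2 * x - 3 * p\<close>. The bound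
  splits the first moment into a multiple of the zeroth moment and a vanishing part.\<close>

lemma le_tail:
  assumes "0 < p" shows "x \<le> 4 * p + 2 * tail p x"
  using tail_nonneg[OF assms, of x] tail_eq[of p x] assms by (cases "x \<le> 4 * p") auto

lemma moment0_at_top: "filterlim (moment0 f) at_top at_top"
proof (rule ccontr)
  assume "\<not> ?thesis"
  then obtain Z where Z: "\<not> (\<forall>\<^sub>F t in at_top. Z \<le> moment0 f t)" unfolding filterlim_at_top by blast
  \<comment> \<open>The number of particles is nondecreasing, so exceeding \<open>Z\<close> once
    would mean exceeding it forever. The maximum with 1 provides a positive divisor for
    \<open>p\<close>.\<close>
  have bd: "moment0 f t \<le> max Z 1" if "0 \<le> t" for t
  proof (rule ccontr)
    assume "\<not> ?thesis"
    then have "\<forall>s\<ge>t. Z \<le> moment0 f s" using moment0_mono[OF that] by fastforce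
    then show False using Z unfolding eventually_at_top_linorder by blast
  qed
  \<comment> \<open>Chosen so that \<open>4 * p * max Z 1\<close> is half of
    \<open>\<rho> - \<Phi>0\<close>; in the limit the whole mass would be at most half of
    itself.\<close>
  define p where "p = (\<rho> - \<Phi>0) / (8 * max Z 1)"
  have d: "0 < \<rho> - \<Phi>0" using u_gt[of 0] u_le[of 0] by simp
  have p: "0 < p" using d by (auto simp: p_def)
  have le: "\<rho> - u t \<le> 4 * p * max Z 1 + 2 * mom (tail p) t" if t: "0 \<le> t" for t
  proof -
    have "mom (\<lambda>x. x) t \<le> mom (\<lambda>x. 4 * p * 1 + 2 * tail p x) t"
      using le_tail[OF p] by (intro mom_mono t linear_weight_intros linear_weight_tail p) simp
    also have "\<dots> = 4 * p * moment0 f t + 2 * mom (tail p) t"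
      using t p by (simp only: mom_add mom_cmult moment0_eq linear_weight_intros linear_weight_tail)
    also have "\<dots> \<le> 4 * p * max Z 1 + 2 * mom (tail p) t"
      using bd[OF t] p by (intro add_right_mono mult_left_mono) auto
    finally show ?thesis by (simp add: u_eq)
  qed
  have "\<rho> - \<Phi>0 \<le> 4 * p * max Z 1 + 2 * 0"
  proof (rule tendsto_le)
    show "((\<lambda>t. \<rho> - u t) \<longlongrightarrow> \<rho> - \<Phi>0) at_top" by (intro tendsto_intros u_tendsto)
    show "((\<lambda>t. 4 * p * max Z 1 + 2 * mom (tail p) t) \<longlongrightarrow> 4 * p * max Z 1 + 2 * 0) at_top"
      by (intro tendsto_intros mom_tail_tendsto_0 p)
    show "\<forall>\<^sub>F t in at_top. \<rho> - u t \<le> 4 * p * max Z 1 + 2 * mom (tail p) t"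
      using le unfolding eventually_at_top_linorder by blast
  qed simp
  also have "\<dots> = (\<rho> - \<Phi>0) / 2" by (simp add: p_def max_def)
  finally show False using d by simp
qed

lemma linear_weight_id_mult:
  assumes "continuous_on {0..} \<psi>" "\<And>x. 0 \<le> x \<Longrightarrow> \<bar>\<psi> x\<bar> \<le> B"
  shows "linear_weight (\<lambda>x. x * \<psi> x)"
  by (rule linear_weight_mult_bounded[OF linear_weight_id assms])

text \<open>Subtracting \<open>\<psi> 0\<close> leaves \<open>(\<rho> - u t) * \<psi> 0\<close>,
  whose limit is known, and a remainder \<open>D t\<close>. The remainder is small near 0 by
  continuity of \<open>\<psi>\<close> and boundedness of the mass, and away from 0 because the tail
  moments vanish.\<close>

lemma mom_id_mult_tendsto:
  assumes \<psi>: "continuous_on {0..} \<psi>" and B: "\<And>x. 0 \<le> x \<Longrightarrow> \<bar>\<psi> x\<bar> \<le> B"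
  shows "((\<lambda>t. mom (\<lambda>x. x * \<psi> x) t) \<longlongrightarrow> (\<rho> - \<Phi>0) * \<psi> 0) at_top"
proof -
  define D where "D t = mom (\<lambda>x. x * (\<psi> x - \<psi> 0)) t" for t
  have B0: "0 \<le> B" using B[of 0] by simp
  have B2: "\<bar>\<psi> x - \<psi> 0\<bar> \<le> 2 * B" if "0 \<le> x" for x
    using B[OF that] B[of 0] by (simp add: abs_le_iff)
  have w: "linear_weight (\<lambda>x. x * (\<psi> x - \<psi> 0))"
    by (rule linear_weight_id_mult[of _ "2 * B"]) (use B2 \<psi> in \<open>auto intro!: continuous_intros\<close>)
  have eq: "mom (\<lambda>x. x * \<psi> x) t = (\<rho> - u t) * \<psi> 0 + D t" if "0 \<le> t" for t
  proof -
    have "mom (\<lambda>x. x * \<psi> x) t = mom (\<lambda>x. \<psi> 0 * x + x * (\<psi> x - \<psi> 0)) t"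
      by (rule arg_cong[where f = "\<lambda>h. mom h t"]) (auto simp: algebra_simps)
    also have "\<dots> = \<psi> 0 * mom (\<lambda>x. x) t + D t"
      using that by (simp only: mom_add mom_cmult linear_weight_intros w D_def)
    finally show ?thesis by (simp add: u_eq mult.commute)
  qed
  have "(D \<longlongrightarrow> 0) at_top"
  proof (rule tendstoI)
    fix e :: real assume e: "0 < e"
    define \<eta> where "\<eta> = e / (2 * (\<rho> + 1))"
    have \<eta>: "0 < \<eta>" "\<eta> * \<rho> \<le> e / 2" using e rho_nonneg by (simp_all add: \<eta>_def field_simps)
    obtain d where d: "0 < d" "\<And>x. 0 \<le> x \<Longrightarrow> x < d \<Longrightarrow> \<bar>\<psi> x - \<psi> 0\<bar> \<le> \<eta>"
    proof -
      have "0 \<in> {0::real..}" by simp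
      then obtain d where "d > 0" "\<forall>x\<in>{0..}. dist x 0 < d \<longrightarrow> dist (\<psi> x) (\<psi> 0) < \<eta>"
        using \<psi> \<eta>(1) unfolding continuous_on_iff by blast
      then show ?thesis by (intro that[of d]) (auto simp: dist_real_def less_imp_le)
    qed
    \<comment> \<open>For \<open>x \<ge> d = 4 * p\<close> one has
      \<open>x \<le> 2 * tail p x\<close>; together with the oscillation bound \<open>2 * B\<close>
      this gives the factor \<open>4 * B\<close>.\<close>
    define p where "p = d / 4"
    have p: "0 < p" using d by (simp add: p_def)
    have pt: "\<bar>x * (\<psi> x - \<psi> 0)\<bar> \<le> \<eta> * x + 4 * B * tail p x" if x: "0 < x" for x
    proof (cases "x < d")
      case True
      then have "\<bar>\<psi> x - \<psi> 0\<bar> * x \<le> \<eta> * x" using d(2)[of x] x by (intro mult_right_mono) auto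
      moreover have "0 \<le> 4 * B * tail p x" using B0 tail_nonneg[OF p, of x] by simp
      ultimately have "\<bar>\<psi> x - \<psi> 0\<bar> * x \<le> \<eta> * x + 4 * B * tail p x" by linarith
      then show ?thesis using x by (simp add: abs_mult mult.commute[of x])
    next
      case False
      then have "x \<le> 2 * tail p x" using tail_eq[of p x] p by (simp add: p_def)
      then have "x * \<bar>\<psi> x - \<psi> 0\<bar> \<le> (2 * tail p x) * (2 * B)"
        using B2[of x] x by (intro mult_mono) auto
      moreover have "0 \<le> \<eta> * x" using \<eta> x by simp
      ultimately show ?thesis using x by (simp add: abs_mult mult_ac)
    qed
    have le: "\<bar>D t\<bar> \<le> e / 2 + 4 * B * mom (tail p) t" if t: "0 \<le> t" for t
    proof -
      have wt: "linear_weight (\<lambda>x. \<eta> * x + 4 * B * tail p x)"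
        by (intro linear_weight_intros linear_weight_tail p)
      have E: "mom (\<lambda>x. \<eta> * x + 4 * B * tail p x) t = \<eta> * mom (\<lambda>x. x) t + 4 * B * mom (tail p) t"
        using t p by (simp only: mom_add mom_cmult linear_weight_intros linear_weight_tail)
      have "D t \<le> mom (\<lambda>x. \<eta> * x + 4 * B * tail p x) t"
        unfolding D_def by (rule mom_mono[OF t w wt]) (use pt in \<open>simp add: abs_le_iff\<close>)
      moreover have "- D t \<le> mom (\<lambda>x. \<eta> * x + 4 * B * tail p x) t"
      proof -
        have "mom (\<lambda>x. -1 * (x * (\<psi> x - \<psi> 0))) t \<le> mom (\<lambda>x. \<eta> * x + 4 * B * tail p x) t"
          by (rule mom_mono[OF t linear_weight_cmult[OF w] wt]) (use pt in \<open>simp add: abs_le_iff\<close>)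
        then show ?thesis unfolding D_def mom_cmult by simp
      qed
      moreover have "\<eta> * mom (\<lambda>x. x) t \<le> e / 2"
        using order_trans[OF mult_left_mono[OF mom_id_le[OF t], of \<eta>] \<eta>(2)] \<eta>(1) by simp
      ultimately show ?thesis unfolding E by linarith
    qed
    have "((\<lambda>t. 4 * B * mom (tail p) t) \<longlongrightarrow> 4 * B * 0) at_top"
      by (intro tendsto_intros mom_tail_tendsto_0 p)
    then have "\<forall>\<^sub>F t in at_top. 4 * B * mom (tail p) t < e / 2"
      using e by (intro order_tendstoD(2)) auto
    then show "\<forall>\<^sub>F t in at_top. dist (D t) 0 < e"
      using eventually_ge_at_top[of 0]
    proof eventually_elim
      case (elim t)
      then show ?case using le[of t] by simp
    qed
  qed
  then have "((\<lambda>t. (\<rho> - u t) * \<psi> 0 + D t) \<longlongrightarrow> (\<rho> - \<Phi>0) * \<psi> 0 + 0) at_top"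
    by (intro tendsto_intros u_tendsto)
  moreover have "\<forall>\<^sub>F t in at_top. (\<rho> - u t) * \<psi> 0 + D t = mom (\<lambda>x. x * \<psi> x) t"
    using eventually_ge_at_top[of 0] by eventually_elim (simp add: eq)
  ultimately show ?thesis by (simp add: Lim_transform_eventually)
qed

section \<open>From moments to measures on the half-line\<close>

lemma mass_density_measurable:
  assumes "0 \<le> t"
  shows "(\<lambda>x. x * f t x) \<in> borel_measurable (restrict_space lborel {0..})"
proof -
  have "(\<lambda>x. indicator {0<..} x *\<^sub>R (x * f t x)) \<in> borel_measurable lborel"
    using mom_integrable[OF assms linear_weight_id] unfolding set_integrable_def by (rule borel_measurable_integrable)
  \<comment> \<open>The factor \<open>x\<close> vanishes at 0, so the open and the closed half-line
    give the same function.\<close>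
  also have "(\<lambda>x. indicator {0<..} x *\<^sub>R (x * f t x)) = (\<lambda>x. indicator {0..} x *\<^sub>R (x * f t x))"
    by (rule ext) (auto simp: indicator_def)
  finally show ?thesis by (subst borel_measurable_restrict_space_iff) auto
qed

lemma mass_density_nonneg:
  assumes "0 \<le> t"
  shows "AE x in lborel. 0 \<le> x \<longrightarrow> 0 \<le> x * f t x"
  using f_nonneg[OF assms]
proof eventually_elim
  case (elim x)
  then show ?case by (cases "x = 0") auto
qed

lemma sets_mass_measure: "sets (mass_measure h) = sets (restrict_space borel {0..})"
  unfolding mass_measure_def by (simp add: sets_restrict_space)

lemma mass_measure_le:
  assumes "0 \<le> t"
  shows "emeasure (mass_measure (f t)) {0..} \<le> ennreal \<rho>"
proof -
  have "emeasure (mass_measure (f t)) {0..} =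
      (\<integral>\<^sup>+x. ennreal (x * f t x) * indicator {0..} x \<partial>restrict_space lborel {0..})"
    unfolding mass_measure_def using mass_density_measurable[OF assms]
    by (intro emeasure_density) (auto simp: sets_restrict_space)
  also have "\<dots> = (\<integral>\<^sup>+x. ennreal (x * f t x) * indicator {0..} x * indicator {0..} x \<partial>lborel)"
    by (rule nn_integral_restrict_space) simp
  also have "\<dots> = (\<integral>\<^sup>+x. ennreal (indicator {0<..} x *\<^sub>R (x * f t x)) \<partial>lborel)"
    by (rule nn_integral_cong) (auto simp: indicator_def)
  also have "\<dots> = ennreal (mom (\<lambda>x. x) t)"
    unfolding mom_def set_lebesgue_integral_def
  proof (rule nn_integral_eq_integral)
    show "integrable lborel (\<lambda>x. indicator {0<..} x *\<^sub>R (x * f t x))"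
      using mom_integrable[OF assms linear_weight_id] unfolding set_integrable_def .
    show "AE x in lborel. 0 \<le> indicator {0<..} x *\<^sub>R (x * f t x)"
      using mass_density_nonneg[OF assms] by eventually_elim (auto simp: indicator_def)
  qed
  also have "\<dots> \<le> ennreal \<rho>" by (intro ennreal_leI mom_id_le assms)
  finally show ?thesis .
qed

lemma integral_mass_measure:
  assumes "0 \<le> t" and \<psi>: "continuous_on {0..} \<psi>"
  shows "(\<integral>x. \<psi> x \<partial>mass_measure (f t)) = mom (\<lambda>x. x * \<psi> x) t"
proof -
  have m: "\<psi> \<in> borel_measurable (restrict_space lborel {0..})"
    using borel_measurable_continuous_on_indicator[OF _ \<psi>]
    by (subst borel_measurable_restrict_space_iff) auto
  have "(\<integral>x. \<psi> x \<partial>mass_measure (f t)) = (\<integral>x. (x * f t x) *\<^sub>R \<psi> x \<partial>restrict_space lborel {0..})"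
    unfolding mass_measure_def
    using m mass_density_measurable[OF assms(1)] mass_density_nonneg[OF assms(1)]
    by (intro integral_density) (auto simp: AE_restrict_space_iff)
  also have "\<dots> = (\<integral>x. indicator {0..} x *\<^sub>R ((x * f t x) *\<^sub>R \<psi> x) \<partial>lborel)"
    by (rule integral_restrict_space) simp
  also have "\<dots> = mom (\<lambda>x. x * \<psi> x) t"
    unfolding mom_def set_lebesgue_integral_def
    by (rule Bochner_Integration.integral_cong) (auto simp: indicator_def)
  finally show ?thesis .
qed

lemma mass_measure_tendsto:
  "weakly_tendsto_at_top \<rho> (\<lambda>t. mass_measure (f t)) (scale_measure (ennreal (\<rho> - \<Phi>0)) dirac0)"
  unfolding weakly_tendsto_at_top_def
proof (intro conjI allI impI)
  show "mass_measure (f t) \<in> radon_measures_le \<rho>" if "0 \<le> t" for t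
    using sets_mass_measure mass_measure_le[OF that] by (simp add: radon_measures_le_def)
  have d: "0 \<le> \<rho> - \<Phi>0" using u_gt[of 0] u_le[of 0] by simp
  have sp: "space (restrict_space borel {0::real..}) = {0..}" by (simp add: space_restrict_space)
  have "{0::real..} \<in> sets (restrict_space borel {0..})"
    using sets.top[of "restrict_space borel {0::real..}"] sp by simp
  then have "emeasure dirac0 {0..} = 1" by (simp add: dirac0_def)
  then show "scale_measure (ennreal (\<rho> - \<Phi>0)) dirac0 \<in> radon_measures_le \<rho>"
    using Phi0_nonneg by (simp add: radon_measures_le_def ennreal_leI) (simp add: dirac0_def)
  fix \<psi> :: "real \<Rightarrow> real" assume A: "continuous_on {0..} \<psi> \<and> bounded (\<psi> ` {0..})"
  then have \<psi>: "continuous_on {0..} \<psi>" by simp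
  obtain B where B: "\<forall>y\<in>\<psi> ` {0..}. norm y \<le> B" using A unfolding bounded_iff by blast
  have m: "\<psi> \<in> borel_measurable (restrict_space borel {0..})"
    by (rule borel_measurable_continuous_on_restrict[OF \<psi>])
  have "(\<integral>x. \<psi> x \<partial>dirac0) = \<psi> 0"
    unfolding dirac0_def using m sp by (intro integral_return) auto
  moreover have "(\<integral>x. \<psi> x \<partial>scale_measure (ennreal (\<rho> - \<Phi>0)) dirac0) = (\<rho> - \<Phi>0) * (\<integral>x. \<psi> x \<partial>dirac0)"
    using m by (intro integral_scale_measure d) (simp add: dirac0_def)
  ultimately have r: "(\<integral>x. \<psi> x \<partial>scale_measure (ennreal (\<rho> - \<Phi>0)) dirac0) = (\<rho> - \<Phi>0) * \<psi> 0" by simp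
  have "((\<lambda>t. mom (\<lambda>x. x * \<psi> x) t) \<longlongrightarrow> (\<rho> - \<Phi>0) * \<psi> 0) at_top"
    by (rule mom_id_mult_tendsto[OF \<psi>, of B]) (use B in auto)
  moreover have "\<forall>\<^sub>F t in at_top. mom (\<lambda>x. x * \<psi> x) t = (\<integral>x. \<psi> x \<partial>mass_measure (f t))"
    using eventually_ge_at_top[of 0] by eventually_elim (simp add: integral_mass_measure \<psi>)
  ultimately show "((\<lambda>t. \<integral>x. \<psi> x \<partial>mass_measure (f t)) \<longlongrightarrow>
      (\<integral>x. \<psi> x \<partial>scale_measure (ennreal (\<rho> - \<Phi>0)) dirac0)) at_top"
    unfolding r by (rule Lim_transform_eventually)
qed

end

theorem theorem2p2:
  fixes a b nuc fin :: "real \<Rightarrow> real" and f :: "real \<Rightarrow> real \<Rightarrow> real"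
    and \<Phi>0 \<rho> :: real
  assumes a_cont: "continuous_on {0..} a" and a_nonneg: "\<forall>x\<ge>0. 0 \<le> a x"
    and b_cont: "continuous_on {0..} b" and b_nonneg: "\<forall>x\<ge>0. 0 \<le> b x"
    and nuc_cont: "continuous_on {0..} nuc" and nuc_nonneg: "\<forall>z\<ge>0. 0 \<le> nuc z"
    and a_pos: "\<forall>x>0. 0 < a x"
    and Phi_lim: "((\<lambda>x. b x / a x) \<longlongrightarrow> \<Phi>0) (at_right 0)" and Phi0_nonneg: "0 \<le> \<Phi>0"
    and i: "strict_mono_on {0..} (Phi a b \<Phi>0)"
    and ii: "\<forall>\<epsilon>>0. derivative_in_Linfty a {\<epsilon><..} \<and> derivative_in_Linfty b {\<epsilon><..}"
    and iii: "0 < (INF x\<in>{1<..}. a x)" "set_integrable lborel {0<..<1} (\<lambda>x. 1 / a x)"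
    and iv: "\<exists>C>0. \<forall>x\<ge>0. b x * Phi a b \<Phi>0 x \<ge> 1 / C * min 1 (x\<^sup>2)"
    and v: "\<exists>c>0. \<exists>k0\<ge>1. \<forall>z\<ge>0. nuc z \<ge> c * z powr k0"
    and rho_pos: "0 < \<rho>"
    and fin_nonneg: "AE x\<in>{0<..} in lborel. 0 \<le> fin x" and fin_L1: "fin \<in> L1_weighted"
    and vi: "set_integrable lborel {0<..}
               (\<lambda>x. ((LBINT z:{0..x}. Phi a b \<Phi>0 z) + x\<^sup>2) * fin x)"
    and sol: "LS_global_solution a b nuc \<Phi>0 \<rho> fin f"
  shows "filterlim (moment0 f) at_top at_top
    \<and> (monomer \<rho> f \<longlongrightarrow> \<Phi>0) at_top
    \<and> weakly_tendsto_at_top \<rho> (\<lambda>t. mass_measure (f t))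
         (scale_measure (ennreal (\<rho> - \<Phi>0)) dirac0)"
proof -
  \<comment> \<open>Hypothesis (ii) is used at \<open>\<epsilon> = 1\<close>; on bounded sizes the
    growth bound comes from continuity up to 0.\<close>
  have "derivative_in_Linfty a {1<..}" "derivative_in_Linfty b {1<..}" using ii by auto
  then obtain C D where C: "\<And>x. 0 \<le> x \<Longrightarrow> \<bar>a x\<bar> \<le> C * (1 + x)"
    and D: "\<And>x. 0 \<le> x \<Longrightarrow> \<bar>b x\<bar> \<le> D * (1 + x)"
    using derivative_in_Linfty_imp_linear_growth[OF a_cont]
      derivative_in_Linfty_imp_linear_growth[OF b_cont] by metis
  interpret nucleation_solution a b nuc "fin" f \<Phi>0 \<rho>
  proof
    show "linear_weight a" by (rule linear_weightI[OF a_cont C])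
    show "linear_weight b" by (rule linear_weightI[OF b_cont D])
  qed (use a_pos nuc_cont nuc_nonneg Phi_lim Phi0_nonneg i iii v sol in auto)
  show ?thesis using moment0_at_top u_tendsto mass_measure_tendsto by blast
qed

end
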